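(* Let $\alpha>\frac12$ be a real number and let $f_1\in A(\mathbb T,3/2)$ be a strictly positive function on the torus $\mathbb T$. Then, for $0<x,y<1$, as $N\to\infty$, $$ f_1(1)\,\Bigl(T_N(|1-\chi|^{2\alpha}f_1)\Bigr)^{-1}_{[Nx]+1,[Ny]+1}=N^{2\alpha-1}\,\frac{1}{\Gamma^2(\alpha)}\,G_\alpha(x,y)+o(N^{2\alpha-1}),$$ uniformly in $(x,y)$ for $0<\delta_1\le x,y\le\delta_2<1$ (for any fixed such $\delta_1,\delta_2$), where $$G_\alpha(x,y)=x^\alpha y^\alpha\int_{\max(x,y)}^1\frac{(t-x)^{\alpha-1}(t-y)^{\alpha-1}}{t^{2\alpha}}\,dt .$$
   Context: $\chi(\theta)=e^{i\theta}$; $[t]$ is the integer part of $t$; $\Gamma$ is the Gamma function. $\hat h(j)=\frac1{2\pi}\int_{-\pi}^{\pi}h(e^{i\theta})e^{-ij\theta}\,d\theta$. For $h\in L^1(\mathbb T)$, $T_N(h)$ is the $(N+1)\times(N+1)$ Toeplitz matrix with entries $(T_N(h))_{k+1,l+1}=\hat h(l-k)$, $0\le k,l\le N$. The class $A(\mathbb T,\nu)$ is the set of $c\in L^2(\mathbb T)$ with $\sum_{n\in\mathbb Z}|n|^{\nu}|\hat c(n)|<\infty$. *)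

theory Defs
  imports "HOL-Analysis.Analysis" "Jordan_Normal_Form.Gauss_Jordan_Elimination"
begin

text \<open>Functions on the torus are functions on \<^typ>\<open>complex\<close>, of which only the values on the
  unit circle \<^term>\<open>sphere (0::complex) 1\<close> matter.\<close>

definition fourier_coeff :: "(complex \<Rightarrow> complex) \<Rightarrow> int \<Rightarrow> complex" where
  "fourier_coeff h j =
     complex_of_real (1 / (2 * pi)) *
     set_lebesgue_integral lebesgue {-pi..pi} (\<lambda>\<theta>. h (cis \<theta>) * cis (- (of_int j * \<theta>)))"

definition L2_torus :: "(complex \<Rightarrow> complex) set" where
  "L2_torus = {c. set_borel_measurable lebesgue {-pi..pi} (\<lambda>\<theta>. c (cis \<theta>)) \<and>
                  set_integrable lebesgue {-pi..pi} (\<lambda>\<theta>. (cmod (c (cis \<theta>)))\<^sup>2)}"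

definition A_torus :: "real \<Rightarrow> (complex \<Rightarrow> complex) set" where
  "A_torus \<nu> = {c \<in> L2_torus.
     (\<lambda>n::int. \<bar>real_of_int n\<bar> powr \<nu> * cmod (fourier_coeff c n)) summable_on UNIV}"

text \<open>Membership in \<^term>\<open>A_torus \<nu>\<close> depends only on the a.e. class of \<open>c\<close>. Where point values
  or pointwise positivity matter, the continuous representative (which exists for \<open>\<nu> \<ge> 0\<close>,
  as the Fourier series converges absolutely) has to be selected by a continuity assumption.\<close>

text \<open>Matrix indices of \<^typ>\<open>complex mat\<close> start at 0, so row \<open>k\<close> and column \<open>l\<close> here are
  row \<open>k + 1\<close> and column \<open>l + 1\<close> in one-based numbering.\<close>

definition toeplitz :: "nat \<Rightarrow> (complex \<Rightarrow> complex) \<Rightarrow> complex mat" where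
  "toeplitz N h = mat (N + 1) (N + 1) (\<lambda>(k, l). fourier_coeff h (int l - int k))"

definition G_kernel :: "real \<Rightarrow> real \<Rightarrow> real \<Rightarrow> real" where
  "G_kernel \<alpha> x y = x powr \<alpha> * y powr \<alpha> *
     set_lebesgue_integral lebesgue {max x y..1}
       (\<lambda>t. (t - x) powr (\<alpha> - 1) * (t - y) powr (\<alpha> - 1) / t powr (2 * \<alpha>))"

definition singular_symbol :: "real \<Rightarrow> (complex \<Rightarrow> real) \<Rightarrow> complex \<Rightarrow> complex" where
  "singular_symbol \<alpha> f z = complex_of_real (cmod (1 - z) powr (2 * \<alpha>) * f z)"

end

theory Submission
  imports Defs "HOL-Real_Asymp.Real_Asymp" "Jordan_Normal_Form.Determinant"
begin

text \<open>For the pure symbol \<open>w = |1 - \<chi>|\<^sup>2\<^sup>\<alpha>\<close> the orthogonal polynomials are explicit hypergeometric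
  polynomials, so \<open>T\<^sub>N(w)\<^sup>-\<^sup>1\<close> is an explicit finite sum \<open>K\<^sub>N\<close> whose scaling limit is a Riemann-type
  integral, namely \<open>G\<^sub>\<alpha> / \<Gamma>(\<alpha>)\<^sup>2\<close>.
  For a general \<open>f\<^sub>1\<close> the difference of the entries of \<open>f\<^sub>1(1) T\<^sub>N(w f\<^sub>1)\<^sup>-\<^sup>1\<close> and \<open>T\<^sub>N(w)\<^sup>-\<^sup>1\<close> is
  \<open>1/(2\<pi>) \<integral> w (f\<^sub>1(1) - f\<^sub>1) U V\<close>, with \<open>U\<close> and \<open>V\<close> the (conjugated) trigonometric polynomials of a column of
  each inverse.  Near frequency 0 this is small by continuity of \<open>f\<^sub>1\<close>.  Away from 0 it is small because a
  column of \<open>K\<^sub>N\<close> is close in energy both to the corresponding column of \<open>K\<^sub>N\<^sub>-\<^sub>1\<close> and to its shift by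
  one: all energies involved are entries of \<open>K\<^sub>N\<close> and \<open>K\<^sub>N\<^sub>-\<^sub>1\<close>, to which the scaling limit applies.
  Uniformity follows from convergence along arbitrary sequences and compactness.\<close>

section \<open>Orthogonal polynomials and the inverse for the pure symbol\<close>

text \<open>The obstacle is that only limits of single entries are available, with no pointwise
  control of \<open>U\<close> or \<open>V\<close>, so every estimate is made in the energy
  \<open>\<integral> w |.|^2\<close>. Pairing a polynomial with column \<open>k\<close> of
  \<open>K_N\<close> in the weight \<open>w\<close> reads off its \<open>k\<close>-th coefficient.
  Hence the squared distance from that column to a polynomial \<open>g\<close> of degree at most
  \<open>N\<close> is the energy of \<open>g\<close>, plus \<open>K_N(k,k)\<close>, minus
  \<open>2 Re g_k\<close>. For \<open>g\<close> the column \<open>k\<close> of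
  \<open>K_(N-1)\<close> and for its shift, this is a combination of entries whose coefficients sum
  to zero; neighbouring entries share a scaling limit, so it is \<open>o(N^(2\<alpha>-1))\<close>.
  The shift raises the degree by one, which is why the comparison passes through order
  \<open>N-1\<close>. A polynomial almost unchanged by the shift has little energy where
  \<open>|1 - \<chi>|\<close> is bounded below. About \<open>U\<close> only its total energy is
  needed, and a positive lower bound of \<open>f1\<close> supplies that. The condition
  \<open>\<alpha> > 1/2\<close> enters on the diagonal: for \<open>x = y\<close> the integrand of
  \<open>G\<close> behaves like \<open>(t - x)^(2\<alpha>-2)\<close>.\<close>

lemma minus_one_powi_add_double: "(-1::real) powi (i + 2 * j) = (-1) powi i"
  by (simp add: power_int_add power_int_mult)

lemma minus_one_powi_diff: "(-1::real) powi (i - 1) = - ((-1) powi i)"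
  by (simp add: power_int_diff)

text \<open>The Taylor coefficients of \<open>(1 - z)^(-s)\<close>.\<close>

definition rising_ratio :: "real \<Rightarrow> nat \<Rightarrow> real" where
  "rising_ratio s n = pochhammer s n / fact n"

lemma rising_ratio_0 [simp]: "rising_ratio s 0 = 1"
  by (simp add: rising_ratio_def)

lemma rising_ratio_Suc: "rising_ratio s (Suc n) = rising_ratio s n * (s + n) / (n + 1)"
  by (simp add: rising_ratio_def pochhammer_Suc field_simps)

lemma rising_ratio_pos: "s > 0 \<Longrightarrow> rising_ratio s n > 0"
  by (simp add: rising_ratio_def pochhammer_pos)

lemma rising_ratio_shift: "s > 0 \<Longrightarrow> rising_ratio s n = rising_ratio (s + 1) n * s / (s + n)"
proof -
  assume s: "s > 0"
  have "pochhammer s n * (s + n) = s * pochhammer (s + 1) n"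
    using pochhammer_rec'[of s n] pochhammer_rec[of s n] by (simp add: algebra_simps)
  moreover have "s + n > 0" using s by simp
  ultimately show ?thesis by (simp add: rising_ratio_def nonzero_eq_divide_eq mult.commute)
qed

text \<open>Closed form of the Fourier coefficients of \<open>|1 - \<chi>|^(2a)\<close>, identified
  as such in \<open>integral_fh_weight_cis\<close>. Writing the denominators with the entire
  function \<open>rGamma\<close> makes the coefficients vanish by themselves for integer
  \<open>a < |n|\<close>.\<close>

definition fh_coeff :: "real \<Rightarrow> int \<Rightarrow> real" where
  "fh_coeff a n = (-1) powi n * Gamma (2 * a + 1) * rGamma (a + of_int n + 1) * rGamma (a - of_int n + 1)"

lemma fh_coeff_minus: "fh_coeff a (- n) = fh_coeff a n"
  using minus_one_powi_add_double[of "-n" n] by (simp add: fh_coeff_def algebra_simps)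

text \<open>The coefficient of \<open>z\<^sup>k\<close> in the monic orthogonal polynomial of degree \<open>m\<close> for the weight \<open>|1 - z|\<^sup>2\<^sup>a\<close>.\<close>

definition fh_opoly :: "real \<Rightarrow> nat \<Rightarrow> nat \<Rightarrow> real" where
  "fh_opoly a m k = (if k \<le> m then rising_ratio (a + 1) k * rising_ratio a (m - k) / rising_ratio (a + 1) m else 0)"

text \<open>The Szego recursion with Verblunsky coefficient \<open>- a / (a + m + 1)\<close>.\<close>

lemma fh_opoly_Suc:
  assumes a: "a > 0" and k: "k \<le> Suc m"
  shows "fh_opoly a (Suc m) k = (if k = 0 then 0 else fh_opoly a m (k - 1)) + a / (a + m + 1) * fh_opoly a m (m - k) * (if k \<le> m then 1 else 0)"
proof -
  define A where "A = rising_ratio (a + 1)"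
  have pos: "A n > 0" for n using a by (simp add: A_def rising_ratio_pos)
  have AS: "A (Suc n) = A n * (a + n + 1) / (n + 1)" for n by (simp add: A_def rising_ratio_Suc algebra_simps)
  have B: "rising_ratio a n = A n * a / (a + n)" for n using rising_ratio_shift[OF a, of n] by (simp add: A_def)
  show ?thesis
  proof (cases "k = 0")
    case True
    have "A m \<noteq> 0" "A (Suc m) \<noteq> 0" "A 0 = 1" using pos[of m] pos[of "Suc m"] by (simp_all add: A_def)
    with True a show ?thesis
      unfolding fh_opoly_def A_def[symmetric] B by (simp add: add_ac)
  next
    case False
    show ?thesis
    proof (cases "k = Suc m")
      case True
      have "A m \<noteq> 0" "A (Suc m) \<noteq> 0" using pos[of m] pos[of "Suc m"] by simp_all
      with True show ?thesis unfolding fh_opoly_def A_def[symmetric] by simp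
    next
      case F2: False
      with False k obtain i j where ij: "k = Suc i" "m = Suc i + j"
        by (metis le_SucE le_Suc_ex not0_implies_Suc)
      have nz: "A i > 0" "A j > 0" "A (Suc (i + j)) > 0" "a + i + 1 > 0" "a + j + 1 > 0" "a + i + j + 2 > 0"
        using pos a by auto
      have 1: "Suc m - k = Suc j" "m - (k - 1) = Suc j" "m - k = j" "m - (m - k) = Suc i" "Suc m = Suc (Suc (i + j))" "m = Suc (i+j)"
        using ij by auto
      have "fh_opoly a (Suc m) k = A (Suc i) * (A (Suc j) * a / (a + Suc j)) / A (Suc (Suc (i + j)))"
        unfolding fh_opoly_def A_def[symmetric] B using ij 1 by simp
      \<comment> \<open>Cancelling \<open>A i * A j * a / A m\<close> leaves \<open>(a + i + 1) * (i
        + j + 2) = (i + 1) * (a + i + j + 2) + a * (j + 1)\<close>.\<close>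
      also have "\<dots> = A i * (A (Suc j) * a / (a + Suc j)) / A m + a / (a + m + 1) * (A j * (A (Suc i) * a / (a + Suc i)) / A m)"
      proof -
        have 2: "A (Suc n) * a / (a + Suc n) = A n * a / (n + 1)" for n
          using a unfolding AS by (simp add: divide_simps)
        have 3: "A (Suc (Suc (i + j))) = A m * (a + i + j + 2) / (i + j + 2)"
          unfolding AS[of "Suc (i + j)"] 1 by (simp add: algebra_simps)
        have "a + m + 1 = a + i + j + 2" using 1 by simp
        then show ?thesis
          unfolding 2 3 AS[of i] using nz(1,2,4,6) pos[of m] by (simp add: divide_simps) (simp add: algebra_simps)
      qed
      also have "\<dots> = (if k = 0 then 0 else fh_opoly a m (k - 1)) + a / (a + m + 1) * fh_opoly a m (m - k) * (if k \<le> m then 1 else 0)"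
        unfolding fh_opoly_def A_def[symmetric] B using ij 1 by simp
      finally show ?thesis .
    qed
  qed
qed

text \<open>Stating the closed form for all integers \<open>j\<close>, not only for \<open>0 \<le> j \<le> m\<close>, lets the Szego recursion
  prove it by induction on \<open>m\<close>. The product vanishes exactly for \<open>0 \<le> j < m\<close>.\<close>

lemma sum_fh_opoly_fh_coeff:
  assumes a: "a > 0"
  shows "(\<Sum>k\<le>m. fh_opoly a m k * fh_coeff a (j - int k)) =
    Gamma (2 * a + 1) * pochhammer (2 * a + 1) m / pochhammer (a + 1) m * (-1) powi (j + int m) *
    (\<Prod>i<m. of_int j - real i) * rGamma (a + of_int j + 1) * rGamma (a - of_int j + 1 + m)"
proof (induction m arbitrary: j)
  case 0
  show ?case by (simp add: fh_opoly_def fh_coeff_def)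
next
  case (Suc m)
  define R where "R = (\<lambda>j. \<Sum>k\<le>m. fh_opoly a m k * fh_coeff a (j - int k))"
  define C where "C = Gamma (2 * a + 1) * pochhammer (2 * a + 1) m / pochhammer (a + 1) m"
  define P where "P = (\<Prod>i<m. of_int j - 1 - real i)"
  define E where "E = (-1::real) powi (j + int m)"
  define g where "g = rGamma (a + of_int j + 1)"
  define h where "h = rGamma (a - of_int j + 2 + m)"
  define \<rho> where "\<rho> = a / (a + m + 1)"
  have "(\<Sum>k\<le>Suc m. fh_opoly a (Suc m) k * fh_coeff a (j - int k)) =
    (\<Sum>k\<le>Suc m. (if k = 0 then 0 else fh_opoly a m (k - 1) * fh_coeff a (j - int k))
     + \<rho> * ((if k \<le> m then 1 else 0) * (fh_opoly a m (m - k) * fh_coeff a (j - int k))))"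
    by (intro sum.cong) (auto simp: fh_opoly_Suc[OF a] algebra_simps \<rho>_def)
  also have "\<dots> = (\<Sum>k\<le>Suc m. (if k = 0 then 0 else fh_opoly a m (k - 1) * fh_coeff a (j - int k)))
     + \<rho> * (\<Sum>k\<le>Suc m. ((if k \<le> m then 1 else 0) * (fh_opoly a m (m - k) * fh_coeff a (j - int k))))"
    by (simp only: sum.distrib sum_distrib_left)
  also have "(\<Sum>k\<le>Suc m. (if k = 0 then 0 else fh_opoly a m (k - 1) * fh_coeff a (j - int k))) = R (j - 1)"
    unfolding R_def by (simp only: sum.atMost_Suc_shift) (simp add: algebra_simps)
  also have "(\<Sum>k\<le>Suc m. ((if k \<le> m then 1 else 0) * (fh_opoly a m (m - k) * fh_coeff a (j - int k))))
     = (\<Sum>k\<le>m. fh_opoly a m (m - k) * fh_coeff a (j - int k))" by simp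
  also have "\<dots> = (\<Sum>k\<le>m. fh_opoly a m k * fh_coeff a (j - int (m - k)))"
    by (rule sum.reindex_bij_witness[of _ "\<lambda>k. m - k" "\<lambda>k. m - k"]) auto
  \<comment> \<open>Evenness of \<open>fh_coeff\<close> turns the reversed polynomial at
    \<open>j\<close> into the original one at \<open>m - j\<close>, so the induction hypothesis
    applies to both terms of the recursion.\<close>
  also have "\<dots> = R (int m - j)"
    unfolding R_def
  proof (intro sum.cong refl)
    fix k assume "k \<in> {..m}"
    then have "j - int (m - k) = - (int m - j - int k)" by (simp add: of_nat_diff)
    then show "fh_opoly a m k * fh_coeff a (j - int (m - k)) = fh_opoly a m k * fh_coeff a (int m - j - int k)"
      by (simp only: fh_coeff_minus)
  qed
  also have "R (j - 1) = C * (- E) * P * ((a + of_int j) * g) * h"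
  proof -
    have "rGamma (a + of_int j) = (a + of_int j) * g"
      unfolding g_def by (rule rGamma_plus1[symmetric])
    moreover have "(- 1::real) powi (j - 1 + int m) = - E"
      unfolding E_def by (metis minus_one_powi_diff add_diff_eq diff_add_eq)
    ultimately show ?thesis unfolding R_def Suc.IH C_def P_def h_def by (simp add: algebra_simps)
  qed
  also have "R (int m - j) = C * E * P * g * ((a - of_int j + 1 + m) * h)"
  proof -
    have "rGamma (a - of_int j + 1 + m) = (a - of_int j + 1 + m) * h"
      unfolding h_def using rGamma_plus1[of "a - of_int j + 1 + m"] by (simp add: algebra_simps)
    \<comment> \<open>Read backwards, the factors at \<open>m - j\<close> are the negatives of
      \<open>j - 1 - i\<close>; the sign \<open>(-1)^m\<close> so produced restores the parity of
      \<open>j + m\<close>.\<close>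
    moreover have "(- 1::real) powi (int m - j + int m) * (\<Prod>i<m. of_int (int m - j) - real i) = E * P"
    proof -
      have "(\<Prod>i<m. of_int (int m - j) - real i) = (\<Prod>i<m. of_int (int m - j) - real (m - Suc i))"
        by (rule prod.nat_diff_reindex[symmetric])
      also have "\<dots> = (\<Prod>i<m. - 1 * (of_int j - 1 - real i))"
        by (intro prod.cong) (auto simp: of_nat_diff)
      also have "\<dots> = (-1) ^ m * P" unfolding P_def by (subst prod.distrib) simp
      finally have 1: "(\<Prod>i<m. of_int (int m - j) - real i) = (-1) ^ m * P" .
      have "(- 1::real) powi (int m - j + int m) * (-1) ^ m = (-1) powi (int m - j + int m) * (-1) powi (int m)"
        by simp
      also have "\<dots> = (-1) powi (int m - j + int m + int m)" by (rule power_int_add[symmetric]) simp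
      also have "\<dots> = (-1) powi ((j + int m) + 2 * (int m - j))" by (simp add: algebra_simps)
      also have "\<dots> = E" unfolding E_def by (rule minus_one_powi_add_double)
      finally show ?thesis unfolding 1 by (simp add: mult.assoc[symmetric])
    qed
    moreover have "R (int m - j) = C * ((- 1) powi (int m - j + int m) * (\<Prod>i<m. of_int (int m - j) - real i))
        * rGamma (a + of_int (int m - j) + 1) * rGamma (a - of_int (int m - j) + 1 + m)"
      unfolding R_def Suc.IH C_def by (simp only: mult.assoc)
    moreover have "a + of_int (int m - j) + 1 = a - of_int j + 1 + m" "a - of_int (int m - j) + 1 + m = a + of_int j + 1"
      by simp_all
    ultimately show ?thesis by (simp only: g_def[symmetric] mult_ac)
  qed
  also have "C * (- E) * P * ((a + of_int j) * g) * h + \<rho> * (C * E * P * g * ((a - of_int j + 1 + m) * h))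
     = C * (- E) * P * g * h * ((a + of_int j) - \<rho> * (a - of_int j + 1 + m))"
    by (simp add: algebra_simps)
  \<comment> \<open>The value of the Verblunsky coefficient makes the terms free of \<open>j\<close>
    cancel. The remaining factor \<open>j\<close> completes the product, and the quotient extends
    both Pochhammer symbols by one factor.\<close>
  also have "(a + of_int j) - \<rho> * (a - of_int j + 1 + m) = of_int j * (2 * a + 1 + m) / (a + 1 + m)"
    using a unfolding \<rho>_def by (simp add: divide_simps) (simp add: algebra_simps)
  also have "C * (- E) * P * g * h * (of_int j * (2 * a + 1 + m) / (a + 1 + m))
     = (C * (2 * a + 1 + m) / (a + 1 + m)) * (- E) * (of_int j * P) * g * h" by simp
  also have "of_int j * P = (\<Prod>i<Suc m. of_int j - real i)"
    unfolding P_def by (simp only: prod.lessThan_Suc_shift) (simp add: algebra_simps)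
  also have "- E = (-1) powi (j + int (Suc m))"
    unfolding E_def by (simp add: power_int_add algebra_simps)
  also have "C * (2 * a + 1 + m) / (a + 1 + m) = Gamma (2 * a + 1) * pochhammer (2 * a + 1) (Suc m) / pochhammer (a + 1) (Suc m)"
    unfolding C_def by (simp add: pochhammer_Suc)
  also have "h = rGamma (a - of_int j + 1 + Suc m)" unfolding h_def by (simp add: algebra_simps)
  finally show ?case unfolding g_def .
qed

section \<open>Norms, orthogonality and the inverse of the pure Toeplitz matrix\<close>

definition fh_norm :: "real \<Rightarrow> nat \<Rightarrow> real" where
  "fh_norm a m = fh_coeff a 0 * rising_ratio (2 * a + 1) m / (rising_ratio (a + 1) m)\<^sup>2"

text \<open>The coefficient matrix of the Christoffel-Darboux kernel, that is, of the reproducing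
  kernel of the polynomials of degree at most \<open>N\<close>.\<close>

definition fh_inverse :: "real \<Rightarrow> nat \<Rightarrow> nat \<Rightarrow> nat \<Rightarrow> real" where
  "fh_inverse a N k l = (\<Sum>m\<le>N. fh_opoly a m k * fh_opoly a m l / fh_norm a m)"

lemma fh_coeff_0: "a > 0 \<Longrightarrow> fh_coeff a 0 = Gamma (2 * a + 1) / (Gamma (a + 1))\<^sup>2"
  by (simp add: fh_coeff_def rGamma_inverse_Gamma power2_eq_square field_simps)

lemma fh_coeff_0_pos: "a > 0 \<Longrightarrow> fh_coeff a 0 > 0"
  unfolding fh_coeff_0 by (intro divide_pos_pos zero_less_power Gamma_real_pos) auto

lemma fh_norm_pos: "a > 0 \<Longrightarrow> fh_norm a m > 0"
  unfolding fh_norm_def by (intro divide_pos_pos mult_pos_pos zero_less_power rising_ratio_pos fh_coeff_0_pos) auto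

lemma fh_opoly_diag: "a > 0 \<Longrightarrow> fh_opoly a m m = 1"
  using rising_ratio_pos[of "a + 1" m] by (simp add: fh_opoly_def)

text \<open>In the closed form of \<open>sum_fh_opoly_fh_coeff\<close> the product has a zero factor
  for \<open>j < m\<close>, so the polynomial of degree \<open>m\<close> is orthogonal to all lower
  powers; symmetry covers the other order, and the value at \<open>j = m\<close> is the norm. All
  sums run to \<open>N\<close> so that the result reads as a matrix identity.\<close>

lemma fh_opoly_orthogonal:
  assumes a: "a > 0" and "n \<le> N" "m \<le> N"
  shows "(\<Sum>j\<le>N. \<Sum>k\<le>N. fh_opoly a n j * fh_opoly a m k * fh_coeff a (int j - int k))
    = (if n = m then fh_norm a m else 0)"
proof -
  define R where "R = (\<lambda>m j. \<Sum>k\<le>m. fh_opoly a m k * fh_coeff a (int j - int k))"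
  define S where "S = (\<lambda>n m. \<Sum>j\<le>N. \<Sum>k\<le>N. fh_opoly a n j * fh_opoly a m k * fh_coeff a (int j - int k))"
  have S_eq: "S n m = (\<Sum>j\<le>n. fh_opoly a n j * R m j)" if "n \<le> N" "m \<le> N" for n m
  proof -
    have "S n m = (\<Sum>j\<le>N. \<Sum>k\<le>m. fh_opoly a n j * fh_opoly a m k * fh_coeff a (int j - int k))"
      unfolding S_def using that by (intro sum.cong refl sum.mono_neutral_right) (auto simp: fh_opoly_def)
    also have "\<dots> = (\<Sum>j\<le>n. \<Sum>k\<le>m. fh_opoly a n j * fh_opoly a m k * fh_coeff a (int j - int k))"
      using that by (intro sum.mono_neutral_right) (auto simp: fh_opoly_def)
    finally show ?thesis by (simp add: R_def sum_distrib_left mult.assoc)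
  qed
  have R0: "R m j = 0" if "j < m" for m j
  proof -
    have "(\<Prod>i<m. of_int (int j) - real i) = 0" using that by auto
    then show ?thesis unfolding R_def sum_fh_opoly_fh_coeff[OF a] by simp
  qed
  have Rm: "R m m = fh_norm a m" for m
  proof -
    have "(\<Prod>i<m. of_int (int m) - real i) = (\<Prod>i<m. of_int (int m) - real (m - Suc i))"
      by (rule prod.nat_diff_reindex[symmetric])
    also have "\<dots> = (\<Prod>i<m. real (Suc i))" by (intro prod.cong) (auto simp: of_nat_diff)
    also have "\<dots> = fact m" by (simp add: fact_prod_Suc atLeast0LessThan)
    finally have 1: "(\<Prod>i<m. of_int (int m) - real i) = fact m" .
    have 2: "(-1::real) powi (int m + int m) = 1"
      using minus_one_powi_add_double[of 0 "int m"] by simp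
    have 3: "rGamma (a + 1) = pochhammer (a + 1) m * rGamma (a + m + 1)"
      using pochhammer_rGamma[of "a + 1" m] by (simp add: add_ac)
    have "pochhammer (a + 1) m > 0" using a by (simp add: pochhammer_pos)
    then show ?thesis
      unfolding R_def sum_fh_opoly_fh_coeff[OF a] 1 2
      by (simp add: fh_norm_def fh_coeff_def rising_ratio_def 3 power2_eq_square)
  qed
  have sym: "S n m = S m n"
  proof -
    have "S n m = (\<Sum>k\<le>N. \<Sum>j\<le>N. fh_opoly a n j * fh_opoly a m k * fh_coeff a (int j - int k))"
      unfolding S_def by (rule sum.swap)
    also have "\<dots> = S m n"
      unfolding S_def
    proof (intro sum.cong refl)
      fix j k :: nat
      have "fh_coeff a (int j - int k) = fh_coeff a (int k - int j)"
        using fh_coeff_minus[of a "int k - int j"] by simp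
      then show "fh_opoly a n j * fh_opoly a m k * fh_coeff a (int j - int k)
          = fh_opoly a m k * fh_opoly a n j * fh_coeff a (int k - int j)" by simp
    qed
    finally show ?thesis .
  qed
  have lt: "S n m = 0" if "n < m" "m \<le> N" for n m
    using that by (simp add: S_eq R0)
  have "S m m = fh_norm a m"
  proof -
    have "S m m = (\<Sum>j\<in>{m}. fh_opoly a m j * R m j)"
      unfolding S_eq[OF assms(3,3)] by (rule sum.mono_neutral_right) (auto simp: R0)
    then show ?thesis by (simp add: Rm fh_opoly_diag a)
  qed
  then have "S n m = (if n = m then fh_norm a m else 0)"
    using lt[of n m] lt[of m n] sym assms by (cases n m rule: linorder_cases) auto
  then show ?thesis by (simp add: S_def)
qed

text \<open>By orthogonality, pairing the image \<open>Y\<close> of column \<open>l\<close> with the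
  polynomial of degree \<open>n\<close> gives that polynomial's \<open>l\<close>-th coefficient, as
  the unit vector would. The polynomials are monic, hence form a unitriangular system, and forward
  substitution recovers \<open>Y\<close>.\<close>

lemma fh_inverse_toeplitz:
  assumes a: "a > 0" and "l \<le> N" "j \<le> N"
  shows "(\<Sum>k\<le>N. fh_inverse a N k l * fh_coeff a (int j - int k)) = (if j = l then 1 else 0)"
proof -
  define Y where "Y = (\<lambda>j. \<Sum>k\<le>N. fh_inverse a N k l * fh_coeff a (int j - int k))"
  have pair: "(\<Sum>j\<le>N. fh_opoly a n j * Y j) = fh_opoly a n l" if n: "n \<le> N" for n
  proof -
    have "(\<Sum>j\<le>N. fh_opoly a n j * Y j) = (\<Sum>j\<le>N. \<Sum>k\<le>N. \<Sum>m\<le>N.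
        fh_opoly a m l / fh_norm a m * (fh_opoly a n j * fh_opoly a m k * fh_coeff a (int j - int k)))"
      by (simp add: Y_def fh_inverse_def sum_distrib_left sum_distrib_right mult_ac)
    also have "\<dots> = (\<Sum>j\<le>N. \<Sum>m\<le>N. \<Sum>k\<le>N.
        fh_opoly a m l / fh_norm a m * (fh_opoly a n j * fh_opoly a m k * fh_coeff a (int j - int k)))"
      by (intro sum.cong refl sum.swap)
    also have "\<dots> = (\<Sum>m\<le>N. \<Sum>j\<le>N. \<Sum>k\<le>N.
        fh_opoly a m l / fh_norm a m * (fh_opoly a n j * fh_opoly a m k * fh_coeff a (int j - int k)))"
      by (rule sum.swap)
    also have "\<dots> = (\<Sum>m\<le>N. fh_opoly a m l / fh_norm a m * (if n = m then fh_norm a m else 0))"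
      using n by (intro sum.cong refl) (simp only: sum_distrib_left[symmetric] fh_opoly_orthogonal[OF a] atMost_iff)
    also have "\<dots> = (\<Sum>m\<in>{n}. fh_opoly a m l / fh_norm a m * (if n = m then fh_norm a m else 0))"
      using n by (intro sum.mono_neutral_right) auto
    also have "\<dots> = fh_opoly a n l" using fh_norm_pos[OF a, of n] by simp
    finally show ?thesis .
  qed
  have "Y j = (if j = l then 1 else 0)"
    using assms(3)
  proof (induction j rule: less_induct)
    case (less j)
    have "fh_opoly a j l = (\<Sum>i\<le>N. fh_opoly a j i * Y i)" using pair less.prems by simp
    also have "\<dots> = (\<Sum>i\<le>j. fh_opoly a j i * Y i)"
      using less.prems by (intro sum.mono_neutral_right) (auto simp: fh_opoly_def)
    also have "\<dots> = (\<Sum>i<j. fh_opoly a j i * Y i) + Y j"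
      by (simp add: lessThan_Suc_atMost[symmetric] fh_opoly_diag a)
    also have "(\<Sum>i<j. fh_opoly a j i * Y i) = (\<Sum>i<j. if i = l then fh_opoly a j l else 0)"
      using less by (intro sum.cong) auto
    also have "\<dots> = (if l < j then fh_opoly a j l else 0)" by simp
    finally show ?case using fh_opoly_diag[OF a, of j] by (auto simp: fh_opoly_def split: if_splits)
  qed
  then show ?thesis by (simp add: Y_def)
qed

lemma fh_inverse_sym: "fh_inverse a N k l = fh_inverse a N l k"
  by (simp add: fh_inverse_def mult.commute)

text \<open>Allows a column of order \<open>N - 1\<close> to be read as a vector of order
  \<open>N\<close> padded by zero.\<close>

lemma fh_inverse_eq_0: "k > N \<Longrightarrow> fh_inverse a N k l = 0"
  by (simp add: fh_inverse_def fh_opoly_def)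

section \<open>Fourier coefficients of the pure symbol\<close>

definition fh_weight :: "real \<Rightarrow> real \<Rightarrow> real" where
  "fh_weight a \<theta> = (2 - 2 * cos \<theta>) powr a"

lemma cmod_one_minus_cis: "cmod (1 - cis \<theta>) powr (2 * a) = fh_weight a \<theta>"
proof -
  have "(cmod (1 - cis \<theta>))\<^sup>2 = (1 - cos \<theta>)\<^sup>2 + (sin \<theta>)\<^sup>2"
    by (simp add: cmod_power2)
  also have "\<dots> = 2 - 2 * cos \<theta>"
    using sin_cos_squared_add[of \<theta>] by (simp add: power2_eq_square algebra_simps)
  finally have "cmod (1 - cis \<theta>) powr 2 = 2 - 2 * cos \<theta>"
    by (simp add: powr_numeral)
  then show ?thesis unfolding fh_weight_def by (metis powr_powr)
qed

lemma fh_weight_nonneg: "fh_weight a \<theta> \<ge> 0"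
  by (simp add: fh_weight_def)

lemma continuous_on_fh_weight [continuous_intros]:
  "a > 0 \<Longrightarrow> continuous_on S (fh_weight a)"
  unfolding fh_weight_def
  by (intro continuous_on_powr' continuous_intros) auto

lemma cos_lt_one_of_pi: "\<theta> \<in> {-pi..pi} \<Longrightarrow> \<theta> \<noteq> 0 \<Longrightarrow> cos \<theta> < 1"
  using cos_monotone_0_pi[of 0 "\<bar>\<theta>\<bar>"] by auto

text \<open>Integrates the derivative of \<open>w(\<theta>) (sin n\<theta> - sin (n+1)\<theta>)\<close> over a period; the second factor cancels the
  singularity of \<open>w'/w\<close> at 0.\<close>

lemma fh_weight_moment_recurrence:
  fixes n :: nat and a :: real
  assumes a: "a > 0"
  shows "(n + 1 + a) * integral {-pi..pi} (\<lambda>\<theta>. fh_weight a \<theta> * cos (real (n + 1) * \<theta>))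
       = (n - a) * integral {-pi..pi} (\<lambda>\<theta>. fh_weight a \<theta> * cos (real n * \<theta>))"
proof -
  define F where "F = (\<lambda>\<theta>. fh_weight a \<theta> * (sin (real n * \<theta>) - sin (real (n + 1) * \<theta>)))"
  define F' where "F' = (\<lambda>\<theta>. (n - a) * (fh_weight a \<theta> * cos (real n * \<theta>)) - (n + 1 + a) * (fh_weight a \<theta> * cos (real (n + 1) * \<theta>)))"
  have "(F' has_integral F pi - F (-pi)) {-pi..pi}"
  \<comment> \<open>At 0 the base of the power vanishes and the weight need not be differentiable;
    continuity suffices at that one point.\<close>
  proof (rule fundamental_theorem_of_calculus_interior_strong[where S = "{0}"])
    show "continuous_on {-pi..pi} F" unfolding F_def using a by (intro continuous_intros)
    fix \<theta> assume \<theta>: "\<theta> \<in> {-pi<..<pi} - {0}"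
    then have lt: "2 - 2 * cos \<theta> > 0" using cos_lt_one_of_pi[of \<theta>] by auto
    define c s C D where "c = cos \<theta>" and "s = sin \<theta>" and "C = cos (real n * \<theta>)" and "D = sin (real n * \<theta>)"
    have cs: "c * c + s * s = 1" unfolding c_def s_def using sin_cos_squared_add[of \<theta>] by (simp add: power2_eq_square)
    have C1: "cos (real (n + 1) * \<theta>) = C * c - D * s" and D1: "sin (real (n + 1) * \<theta>) = D * c + C * s"
      by (simp_all add: C_def D_def c_def s_def distrib_right cos_add sin_add)
    have w': "fh_weight a \<theta> = (2 - 2 * c) * (2 - 2 * c) powr (a - 1)"
      using lt by (simp add: fh_weight_def c_def powr_diff)
    have "(F has_real_derivative
        fh_weight a \<theta> * (n * cos (real n * \<theta>) - (n + 1) * cos (real (n + 1) * \<theta>))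
        + (a * (2 - 2 * cos \<theta>) powr (a - 1) * (2 * sin \<theta>)) * (sin (real n * \<theta>) - sin (real (n + 1) * \<theta>))) (at \<theta>)"
      unfolding F_def fh_weight_def using lt by (auto intro!: derivative_eq_intros simp: algebra_simps)
    moreover have "fh_weight a \<theta> * (n * cos (real n * \<theta>) - (n + 1) * cos (real (n + 1) * \<theta>))
        + (a * (2 - 2 * cos \<theta>) powr (a - 1) * (2 * sin \<theta>)) * (sin (real n * \<theta>) - sin (real (n + 1) * \<theta>)) = F' \<theta>"
    proof -
      \<comment> \<open>Since \<open>s * s = (1 - c) * (1 + c)\<close>, a factor
        \<open>2 - 2 * c\<close> splits off; it raises the exponent \<open>a - 1\<close> back to
        \<open>a\<close>.\<close>
      have "2 * s * (D - (D * c + C * s)) = - (2 - 2 * c) * (C + (C * c - D * s))"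
      proof -
        have "2 * s * (D - (D * c + C * s)) = 2 * s * D * (1 - c) - 2 * C * (s * s)" by (simp add: algebra_simps)
        also have "\<dots> = 2 * s * D * (1 - c) - 2 * C * ((1 - c) * (1 + c))"
        proof -
          have "s * s = (1 - c) * (1 + c)" using cs by (simp add: algebra_simps)
          then show ?thesis by (simp only:)
        qed
        also have "\<dots> = - (2 - 2 * c) * (C + (C * c - D * s))" by (simp add: algebra_simps)
        finally show ?thesis .
      qed
      note X = this
      have "a * (2 - 2 * c) powr (a - 1) * (2 * s) * (D - (D * c + C * s))
          = a * (2 - 2 * c) powr (a - 1) * (2 * s * (D - (D * c + C * s)))" by (simp only: mult.assoc)
      also have "\<dots> = a * (2 - 2 * c) powr (a - 1) * (- (2 - 2 * c) * (C + (C * c - D * s)))" by (simp only: X)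
      also have "\<dots> = - a * fh_weight a \<theta> * (C + (C * c - D * s))" unfolding w' by (simp add: algebra_simps)
      finally have "a * (2 - 2 * c) powr (a - 1) * (2 * s) * (D - (D * c + C * s)) = - a * fh_weight a \<theta> * (C + (C * c - D * s))" .
      then show ?thesis unfolding F'_def C1 D1 C_def[symmetric] D_def[symmetric] c_def[symmetric] s_def[symmetric]
        by (simp add: algebra_simps)
    qed
    ultimately show "(F has_vector_derivative F' \<theta>) (at \<theta>)"
      by (simp add: has_real_derivative_iff_has_vector_derivative)
  qed auto
  moreover have "F pi = 0" "F (-pi) = 0" 
    using sin_npi[of n] sin_npi[of "n + 1"] by (simp_all del: sin_npi of_nat_add add: F_def)
  ultimately have "integral {-pi..pi} F' = 0" by (simp add: integral_unique)
  moreover have "integral {-pi..pi} F' = (n - a) * integral {-pi..pi} (\<lambda>\<theta>. fh_weight a \<theta> * cos (real n * \<theta>))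
      - (n + 1 + a) * integral {-pi..pi} (\<lambda>\<theta>. fh_weight a \<theta> * cos (real (n + 1) * \<theta>))"
    unfolding F'_def using a
    by (subst Henstock_Kurzweil_Integration.integral_diff) (auto intro!: integrable_continuous_interval continuous_intros)
  ultimately show ?thesis by simp
qed

text \<open>The substitution \<open>t = (1 - cos \<theta>) / 2\<close> gives the Beta integral with
  parameters \<open>a + 1/2\<close> and \<open>1/2\<close>, and Legendre duplication rewrites
  \<open>Gamma (a + 1/2)\<close> through \<open>Gamma (2 * a + 1)\<close>. This starts the
  recurrence for the moments.\<close>

lemma integral_fh_weight:
  assumes a: "a > 0"
  shows "integral {-pi..pi} (fh_weight a) = 2 * pi * fh_coeff a 0"
proof -
  define I where "I = integral {0..pi} (fh_weight a)"
  have int: "fh_weight a integrable_on {c..d}" for c d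
    using a by (intro integrable_continuous_interval continuous_intros)
  have "integral {-pi..-0} (\<lambda>\<theta>. fh_weight a (- \<theta>)) = I"
    unfolding I_def by (rule Henstock_Kurzweil_Integration.integral_reflect_real)
  moreover have "fh_weight a (- \<theta>) = fh_weight a \<theta>" for \<theta> by (simp add: fh_weight_def)
  ultimately have "integral {-pi..0} (fh_weight a) = I" by simp
  then have "integral {-pi..pi} (fh_weight a) = 2 * I"
    using Henstock_Kurzweil_Integration.integral_combine[of "-pi" 0 pi "fh_weight a"] int by (simp add: I_def)
  define f where "f = (\<lambda>t. t powr (a + 1 / 2 - 1) * (1 - t) powr (1 / 2 - 1 :: real))"
  define g where "g = (\<lambda>\<theta>::real. (1 - cos \<theta>) / 2)"
  have f1: "(f has_integral Beta (a + 1 / 2) (1 / 2)) {0..1}"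
    unfolding f_def using a by (intro has_integral_Beta_real) auto
  then have f2: "(f has_integral Beta (a + 1 / 2) (1 / 2)) {0<..<1}"
    by (simp add: has_integral_Icc_iff_Ioo)
  then have "f absolutely_integrable_on {0<..<1}"
    by (intro nonnegative_absolutely_integrable_1) (auto simp: f_def)
  moreover have img: "g ` {0<..<pi} = {0<..<1}"
  proof
    show "g ` {0<..<pi} \<subseteq> {0<..<1}"
      using cos_monotone_0_pi[of 0] cos_monotone_0_pi[of _ pi] by (force simp: g_def)
    show "{0<..<1} \<subseteq> g ` {0<..<pi}"
    proof
      fix t :: real assume "t \<in> {0<..<1}"
      then show "t \<in> g ` {0<..<pi}"
        by (intro image_eqI[of _ _ "arccos (1 - 2 * t)"]) (auto simp: g_def arccos_lt_bounded)
    qed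
  qed
  moreover have inj: "inj_on g {0<..<pi}"
    by (rule inj_onI) (auto simp: g_def intro: cos_inj_pi)
  moreover have "(g has_field_derivative sin \<theta> / 2) (at \<theta> within {0<..<pi})" for \<theta>
    unfolding g_def by (auto intro!: derivative_eq_intros)
  ultimately have "integral {0<..<pi} (\<lambda>\<theta>. \<bar>sin \<theta> / 2\<bar> * f (g \<theta>)) = Beta (a + 1 / 2) (1 / 2)"
    using has_absolute_integral_change_of_variables_1'[of "{0<..<pi}" g "\<lambda>\<theta>. sin \<theta> / 2" f "Beta (a + 1 / 2) (1 / 2)"] f2
    by (simp add: integral_unique)
  moreover have "\<bar>sin \<theta> / 2\<bar> * f (g \<theta>) = 4 powr (- a) * fh_weight a \<theta>" if "\<theta> \<in> {0<..<pi}" for \<theta>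
  proof -
    define P Q where "P = (1 - cos \<theta>) / 2" and "Q = (1 + cos \<theta>) / 2"
    have "P \<in> g ` {0<..<pi}" using that by (auto simp: g_def P_def)
    then have "P \<in> {0<..<1}" unfolding img .
    then have P: "P > 0" "Q > 0" "1 - P = Q" by (auto simp: P_def Q_def field_simps)
    have s: "sin \<theta> > 0" using that by (auto intro: sin_gt_zero)
    \<comment> \<open>The Jacobian is the square root of \<open>t * (1 - t)\<close>; it changes the
      exponents \<open>a - 1/2\<close> and \<open>- 1/2\<close> of the Beta integrand into
      \<open>a\<close> and 0.\<close>
    have "(sin \<theta> / 2)\<^sup>2 = P * Q" by (simp add: P_def Q_def power2_eq_square algebra_simps)
    then have "sin \<theta> / 2 = sqrt (P * Q)" using s by (metis abs_of_pos half_gt_zero real_sqrt_abs)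
    also have "\<dots> = P powr (1/2) * Q powr (1/2)" using P by (simp add: powr_half_sqrt real_sqrt_mult)
    finally have "sin \<theta> / 2 = P powr (1/2) * Q powr (1/2)" .
    then have "\<bar>sin \<theta> / 2\<bar> * f (g \<theta>) = (P powr (1/2) * P powr (a + 1 / 2 - 1)) * (Q powr (1/2) * Q powr (1 / 2 - 1))"
      using s P(3) by (simp only: f_def g_def P_def[symmetric] mult_ac abs_of_pos half_gt_zero)
    also have "\<dots> = P powr a" using P by (simp add: powr_add[symmetric])
    also have "\<dots> = (1 / 4 * (2 - 2 * cos \<theta>)) powr a"
    proof -
      have "P = 1 / 4 * (2 - 2 * cos \<theta>)" by (simp add: P_def field_simps)
      then show ?thesis by (simp only:)
    qed
    also have "\<dots> = 4 powr (- a) * fh_weight a \<theta>"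
    proof -
      have "(1 / 4 :: real) powr a = 4 powr (- a)" using powr_powr[of 4 "-1" a] by (simp add: powr_minus_divide)
      then show ?thesis unfolding fh_weight_def by (simp only: powr_mult)
    qed
    finally show ?thesis .
  qed
  then have "integral {0<..<pi} (\<lambda>\<theta>. \<bar>sin \<theta> / 2\<bar> * f (g \<theta>))
      = integral {0<..<pi} (\<lambda>\<theta>. 4 powr (- a) * fh_weight a \<theta>)"
    by (rule Henstock_Kurzweil_Integration.integral_cong)
  ultimately have "integral {0<..<pi} (\<lambda>\<theta>. 4 powr (- a) * fh_weight a \<theta>) = Beta (a + 1 / 2) (1 / 2)"
    by simp
  then have "4 powr (- a) * I = Beta (a + 1 / 2) (1 / 2)"
    by (simp add: I_def integral_open_interval_real)
  moreover have "4 powr a * 4 powr (- a) = (1::real)" by (simp add: powr_add[symmetric])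
  ultimately have "I = 4 powr a * Beta (a + 1 / 2) (1 / 2)" by (metis mult.assoc mult_1)
  also have "Beta (a + 1 / 2) (1 / 2) = Gamma (a + 1 / 2) * sqrt pi / Gamma (a + 1)"
    by (simp add: Beta_def Gamma_one_half_real add.commute)
  also have "Gamma (a + 1 / 2) = 4 powr (- a) * sqrt pi * Gamma (2 * a + 1) / Gamma (a + 1)"
  proof -
    have ni: "complex_of_real r \<notin> \<int>\<^sub>\<le>\<^sub>0" if "r > 0" for r
      using that by (auto elim!: nonpos_Ints_cases simp: complex_eq_iff)
    have h: "complex_of_real (a + 1 / 2) + 1 / 2 = of_real (a + 1)" by simp
    have "Gamma (complex_of_real (a + 1 / 2)) * Gamma (complex_of_real (a + 1 / 2) + 1 / 2)
      = exp ((1 - 2 * complex_of_real (a + 1 / 2)) * of_real (ln 2)) * of_real (sqrt pi) * Gamma (2 * complex_of_real (a + 1 / 2))"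
      by (rule Gamma_legendre_duplication; (unfold h)?; rule ni; use a in simp)
    also note h
    also have "2 * complex_of_real (a + 1 / 2) = of_real (2 * a + 1)" by simp
    also have "exp ((1 - of_real (2 * a + 1)) * complex_of_real (ln 2)) = of_real (exp (- 2 * a * ln 2))"
      by (simp add: exp_of_real[symmetric])
    finally have "Gamma (a + 1 / 2) * Gamma (a + 1) = exp (- 2 * a * ln 2) * sqrt pi * Gamma (2 * a + 1)"
      unfolding Gamma_complex_of_real of_real_mult[symmetric] by (simp only: of_real_eq_iff)
    moreover have "exp (- 2 * a * ln 2) = 4 powr (- a)"
      using ln_realpow[of 2 2] by (simp add: powr_def)
    moreover have "Gamma (a + 1) > 0" using a by (simp add: Gamma_real_pos)
    ultimately show ?thesis by (simp add: nonzero_eq_divide_eq)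
  qed
  also have "4 powr a * (4 powr (- a) * sqrt pi * Gamma (2 * a + 1) / Gamma (a + 1) * sqrt pi / Gamma (a + 1))
      = (4 powr a * 4 powr (- a)) * (sqrt pi * sqrt pi) * (Gamma (2 * a + 1) / (Gamma (a + 1))\<^sup>2)"
    by (simp add: power2_eq_square)
  also have "\<dots> = pi * fh_coeff a 0"
    using a by (simp add: fh_coeff_0 powr_add[symmetric])
  finally have "I = pi * fh_coeff a 0" .
  with \<open>integral {-pi..pi} (fh_weight a) = 2 * I\<close> show ?thesis by simp
qed

text \<open>The functional equation of \<open>rGamma\<close> gives \<open>fh_coeff\<close> the same
  recurrence as the moments, and \<open>n + 1 + a > 0\<close> can be cancelled. The equation also
  holds at the zeros of \<open>rGamma\<close>, so integer \<open>a\<close> is not a separate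
  case.\<close>

lemma integral_fh_weight_cos:
  assumes a: "a > 0"
  shows "integral {-pi..pi} (\<lambda>\<theta>. fh_weight a \<theta> * cos (real n * \<theta>)) = 2 * pi * fh_coeff a (int n)"
proof (induction n)
  case 0
  then show ?case using integral_fh_weight[OF a] by simp
next
  case (Suc n)
  have "(n + 1 + a) * integral {-pi..pi} (\<lambda>\<theta>. fh_weight a \<theta> * cos (real (n + 1) * \<theta>)) = (n - a) * (2 * pi * fh_coeff a (int n))"
    using fh_weight_moment_recurrence[OF a, of n] Suc by simp
  also have "(n - a) * fh_coeff a (int n) = (n + 1 + a) * fh_coeff a (int (Suc n))"
  proof -
    define p q where "p = rGamma (a + n + 2)" and "q = rGamma (a - n + 1)"
    have "rGamma (a + n + 1) = (a + n + 1) * p"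
      using rGamma_plus1[of "a + n + 1"] by (simp add: p_def add_ac)
    moreover have "rGamma (a - n) = (a - n) * q"
      using rGamma_plus1[of "a - n"] by (simp add: q_def)
    moreover have "a + of_int (int (Suc n)) + 1 = a + n + 2" "a - of_int (int (Suc n)) + 1 = a - n"
      "a + of_int (int n) + 1 = a + n + 1" "a - of_int (int n) + 1 = a - n + 1" by simp_all
    moreover have "(-1::real) powi int n = - ((-1) powi int (Suc n))"
      using minus_one_powi_diff[of "int (Suc n)"] by simp
    ultimately have "fh_coeff a (int n) = - ((-1) powi int (Suc n)) * Gamma (2 * a + 1) * ((a + n + 1) * p) * q"
      "fh_coeff a (int (Suc n)) = (-1) powi int (Suc n) * Gamma (2 * a + 1) * p * ((a - n) * q)"
      unfolding fh_coeff_def p_def q_def by (simp_all only:)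
    then show ?thesis by (simp only:) (simp add: algebra_simps)
  qed
  then have "(n - a) * (2 * pi * fh_coeff a (int n)) = (n + 1 + a) * (2 * pi * fh_coeff a (int (Suc n)))"
    by simp
  finally show ?case using a by simp
qed

lemma integral_fh_weight_cis:
  assumes a: "a > 0"
  shows "integral {-pi..pi} (\<lambda>\<theta>. of_real (fh_weight a \<theta>) * cis (- (of_int n * \<theta>))) = of_real (2 * pi * fh_coeff a n)"
proof -
  have int: "(\<lambda>\<theta>. fh_weight a \<theta> * cos (of_int n * \<theta>)) integrable_on {-pi..pi}"
    "(\<lambda>\<theta>. fh_weight a \<theta> * sin (of_int n * \<theta>)) integrable_on {-pi..pi}"
    using a by (auto intro!: integrable_continuous_interval continuous_intros)
  have c: "integral {-pi..pi} (\<lambda>\<theta>. fh_weight a \<theta> * cos (of_int n * \<theta>)) = 2 * pi * fh_coeff a n"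
  proof (cases n rule: int_cases2)
    case (nonneg k)
    then show ?thesis using integral_fh_weight_cos[OF a, of k] by simp
  next
    case (nonpos k)
    then show ?thesis using integral_fh_weight_cos[OF a, of k] by (simp add: fh_coeff_minus)
  qed
  have "integral {-pi..-(-pi)} (\<lambda>\<theta>. fh_weight a (- \<theta>) * sin (of_int n * (- \<theta>)))
      = integral {-pi..pi} (\<lambda>\<theta>. fh_weight a \<theta> * sin (of_int n * \<theta>))"
    by (rule Henstock_Kurzweil_Integration.integral_reflect_real)
  then have s: "integral {-pi..pi} (\<lambda>\<theta>. fh_weight a \<theta> * sin (of_int n * \<theta>)) = 0"
    by (simp add: fh_weight_def)
  have "((\<lambda>\<theta>. of_real (fh_weight a \<theta> * cos (of_int n * \<theta>)) - \<i> * of_real (fh_weight a \<theta> * sin (of_int n * \<theta>)))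
      has_integral (of_real (2 * pi * fh_coeff a n) - \<i> * of_real 0)) {-pi..pi}"
    using int[THEN integrable_integral] unfolding c s
    by (intro has_integral_diff has_integral_mult_right has_integral_of_real)
  also have "(\<lambda>\<theta>. of_real (fh_weight a \<theta> * cos (of_int n * \<theta>)) - \<i> * of_real (fh_weight a \<theta> * sin (of_int n * \<theta>)))
     = (\<lambda>\<theta>. of_real (fh_weight a \<theta>) * cis (- (of_int n * \<theta>)))"
    by (auto simp: cis.ctr complex_eq_iff fun_eq_iff)
  finally show ?thesis by (simp add: integral_unique)
qed

section \<open>Scaling limit of the pure inverse\<close>

text \<open>Up to the factor \<open>n / (s + n)\<close> the scaled ratio is the reciprocal of
  Euler's sequence for \<open>Gamma s\<close>.\<close>

lemma rising_ratio_asymp: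
  assumes s: "s > 0"
  shows "(\<lambda>n. rising_ratio s n * real n powr (1 - s)) \<longlonglongrightarrow> 1 / Gamma s"
proof -
  have "(\<lambda>n. real n / (s + real n) / Gamma_series s n) \<longlonglongrightarrow> 1 / Gamma s"
  proof (intro tendsto_divide Gamma_series_LIMSEQ)
    show "(\<lambda>n. real n / (s + real n)) \<longlonglongrightarrow> 1"
      by real_asymp
    show "Gamma s \<noteq> 0" using Gamma_real_pos[OF s] by simp
  qed
  then show ?thesis
  proof (rule Lim_transform_eventually)
    show "\<forall>\<^sub>F n in sequentially. real n / (s + real n) / Gamma_series s n = rising_ratio s n * real n powr (1 - s)"
      using eventually_gt_at_top[of 0]
    proof eventually_elim
      case (elim n)
      have "Gamma_series s n = fact n * real n powr s / (pochhammer s n * (s + real n))"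
        using elim by (simp add: Gamma_series_def powr_def pochhammer_Suc)
      moreover have "pochhammer s n > 0" "real n powr s > 0" "s + real n > 0" using s elim by (auto simp: pochhammer_pos)
      ultimately show ?case using elim
        by (simp add: rising_ratio_def powr_diff)
    qed
  qed
qed

text \<open>Because \<open>z > 0\<close>, the index \<open>j\<close> itself tends to infinity, so a
  power asymptotic in \<open>j\<close> can be re-expressed on the scale \<open>N\<close>.\<close>

lemma scaled_asymp:
  fixes N j :: "nat \<Rightarrow> nat" and q :: "nat \<Rightarrow> real"
  assumes N: "filterlim N at_top sequentially" and j: "(\<lambda>i. real (j i) / real (N i)) \<longlonglongrightarrow> z" and z: "z > 0"
    and q: "(\<lambda>n. q n * real n powr (- r)) \<longlonglongrightarrow> c"
  shows "(\<lambda>i. q (j i) * real (N i) powr (- r)) \<longlonglongrightarrow> c * z powr r"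
proof -
  have Npos: "\<forall>\<^sub>F i in sequentially. N i > 0"
    by (rule eventually_compose_filterlim[OF eventually_gt_at_top N])
  have "filterlim (\<lambda>i. real (j i) / real (N i) * real (N i)) at_top sequentially"
    using j z filterlim_compose[OF filterlim_real_sequentially N] by (rule filterlim_tendsto_pos_mult_at_top)
  moreover have "\<forall>\<^sub>F i in sequentially. real (j i) / real (N i) * real (N i) = real (j i)"
    using Npos by eventually_elim simp
  ultimately have "filterlim (\<lambda>i. real (j i)) at_top sequentially"
    using filterlim_cong by fastforce
  then have J: "filterlim j at_top sequentially"
    by (simp add: filterlim_sequentially_iff_filterlim_real)
  have Jpos: "\<forall>\<^sub>F i in sequentially. j i > 0"
    by (rule eventually_compose_filterlim[OF eventually_gt_at_top J])
  have "(\<lambda>i. (q (j i) * real (j i) powr (- r)) * (real (j i) / real (N i)) powr r) \<longlonglongrightarrow> c * z powr r"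
    using z by (intro tendsto_mult tendsto_powr j tendsto_const filterlim_compose[OF q J]) auto
  then show ?thesis
  proof (rule Lim_transform_eventually)
    show "\<forall>\<^sub>F i in sequentially. (q (j i) * real (j i) powr (- r)) * (real (j i) / real (N i)) powr r = q (j i) * real (N i) powr (- r)"
      using Npos Jpos by eventually_elim (simp add: powr_divide powr_minus field_simps)
  qed
qed

text \<open>Writing a sum exactly as the integral of a step function makes dominated convergence
  applicable to it.\<close>

lemma has_integral_step:
  fixes g :: "nat \<Rightarrow> real" and N :: nat
  assumes N: "N > 0"
  shows "((\<lambda>s. g (nat \<lfloor>real N * s\<rfloor>)) has_integral (\<Sum>n<M. g n) / N) {0..M / N}"
proof (induction M)
  case 0
  show ?case by (simp add: has_integral_refl)
next
  case (Suc M)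
  have "((\<lambda>s. g (nat \<lfloor>real N * s\<rfloor>)) has_integral g M / N) {real M / N..real (Suc M) / N}"
  proof (rule has_integral_spike_finite[where S = "{real (Suc M) / N}" and f = "\<lambda>_. g M"])
    have "real M / N \<le> real (Suc M) / N" by (intro divide_right_mono) auto
    then have "measure lborel {real M / N..real (Suc M) / N} *\<^sub>R g M = g M / N"
      by (simp add: content_real diff_divide_distrib[symmetric])
    moreover have "((\<lambda>_. g M) has_integral measure lborel {real M / N..real (Suc M) / N} *\<^sub>R g M) {real M / N..real (Suc M) / N}"
      by (rule has_integral_const_real)
    ultimately show "((\<lambda>_. g M) has_integral g M / N) {real M / N..real (Suc M) / N}" by (simp only:)
    fix s assume "s \<in> {real M / N..real (Suc M) / N} - {real (Suc M) / N}"
    then have "real M \<le> real N * s" "real N * s < real M + 1"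
      using N by (auto simp: field_simps)
    then have "\<lfloor>real N * s\<rfloor> = int M" by (simp add: floor_unique)
    then show "g (nat \<lfloor>real N * s\<rfloor>) = g M" by simp
  qed auto
  from has_integral_combine[OF _ _ Suc this] show ?case
    using N by (simp add: divide_right_mono add_divide_distrib)
qed

lemma tendsto_nat_floor_div:
  fixes N :: "nat \<Rightarrow> nat"
  assumes N: "filterlim N at_top sequentially" and x: "\<xi> \<longlonglongrightarrow> x" "\<And>i. \<xi> i \<ge> 0"
  shows "(\<lambda>i. real (nat \<lfloor>real (N i) * \<xi> i\<rfloor>) / real (N i)) \<longlonglongrightarrow> x"
proof (rule tendsto_sandwich)
  have "(\<lambda>i. 1 / real (N i)) \<longlonglongrightarrow> 0"
    using filterlim_compose[OF lim_1_over_n N] .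
  from tendsto_diff[OF x(1) this] show "(\<lambda>i. \<xi> i - 1 / real (N i)) \<longlonglongrightarrow> x" by simp
  have Npos: "\<forall>\<^sub>F i in sequentially. N i > 0"
    by (rule eventually_compose_filterlim[OF eventually_gt_at_top N])
  show "\<forall>\<^sub>F i in sequentially. \<xi> i - 1 / real (N i) \<le> real (nat \<lfloor>real (N i) * \<xi> i\<rfloor>) / real (N i)"
    using Npos
  proof eventually_elim
    case (elim i)
    have "real (N i) * \<xi> i - 1 \<le> real (nat \<lfloor>real (N i) * \<xi> i\<rfloor>)" by linarith
    then have "(real (N i) * \<xi> i - 1) / real (N i) \<le> real (nat \<lfloor>real (N i) * \<xi> i\<rfloor>) / real (N i)"
      by (rule divide_right_mono) simp
    then show ?case using elim by (simp add: diff_divide_distrib)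
  qed
  show "\<forall>\<^sub>F i in sequentially. real (nat \<lfloor>real (N i) * \<xi> i\<rfloor>) / real (N i) \<le> \<xi> i"
    using Npos
  proof eventually_elim
    case (elim i)
    have "real (nat \<lfloor>real (N i) * \<xi> i\<rfloor>) \<le> real (N i) * \<xi> i" using x(2)[of i] by simp
    then show ?case using elim by (simp add: field_simps)
  qed
qed (rule x)

text \<open>The base \<open>n + 1\<close> is needed at \<open>n = 0\<close>, where
  \<open>0 powr (s - 1)\<close> is 0 but the ratio is 1.\<close>

lemma rising_ratio_bound:
  assumes s: "s > 0"
  obtains C where "C > 0" "\<And>n. rising_ratio s n \<le> C * real (n + 1) powr (s - 1)"
proof -
  have "(\<lambda>n. (rising_ratio s n * real n powr (1 - s)) * (real (n + 1) / real n) powr (1 - s)) \<longlonglongrightarrow> 1 / Gamma s * 1 powr (1 - s)"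
  proof (intro tendsto_mult rising_ratio_asymp s tendsto_powr tendsto_const)
    show "(\<lambda>n. real (n + 1) / real n) \<longlonglongrightarrow> 1" by real_asymp
  qed auto
  then have "(\<lambda>n. rising_ratio s n * real (n + 1) powr (1 - s)) \<longlonglongrightarrow> 1 / Gamma s * 1 powr (1 - s)"
  proof (rule Lim_transform_eventually)
    show "\<forall>\<^sub>F n in sequentially. (rising_ratio s n * real n powr (1 - s)) * (real (n + 1) / real n) powr (1 - s)
        = rising_ratio s n * real (n + 1) powr (1 - s)"
      using eventually_gt_at_top[of 0] by eventually_elim (simp add: powr_divide)
  qed
  then have "Bseq (\<lambda>n. rising_ratio s n * real (n + 1) powr (1 - s))"
    by (intro convergent_imp_Bseq convergentI)
  then obtain C where C: "C > 0" "\<And>n. norm (rising_ratio s n * real (n + 1) powr (1 - s)) \<le> C"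
    by (auto elim: BseqE)
  show thesis
  proof (rule that[OF C(1)])
    fix n
    have "rising_ratio s n * real (n + 1) powr (1 - s) \<le> C" using C(2)[of n] by simp
    moreover have "rising_ratio s n = rising_ratio s n * real (n + 1) powr (1 - s) * real (n + 1) powr (s - 1)"
      by (simp add: powr_add[symmetric])
    ultimately show "rising_ratio s n \<le> C * real (n + 1) powr (s - 1)"
      by (metis mult_right_mono powr_ge_zero)
  qed
qed

lemma rising_ratio_mono: "1 \<le> s \<Longrightarrow> m \<le> n \<Longrightarrow> rising_ratio s m \<le> rising_ratio s n"
proof (rule lift_Suc_mono_le[of "rising_ratio s"])
  fix n assume s: "1 \<le> s"
  have "rising_ratio s n * 1 \<le> rising_ratio s n * ((s + n) / (n + 1))"
    using s rising_ratio_pos[of s n] by (intro mult_left_mono) auto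
  then show "rising_ratio s n \<le> rising_ratio s (Suc n)" by (simp add: rising_ratio_Suc)
qed auto

text \<open>The denominators of the two polynomials cancel against the square in
  \<open>fh_norm\<close>. What is left already has the shape of \<open>G\<close>: a prefactor in
  \<open>k\<close> and \<open>l\<close>, and a sum of discrete analogues of
  \<open>(t-x)^(a-1) (t-y)^(a-1) / t^(2a)\<close>.\<close>

lemma fh_inverse_eq:
  assumes a: "a > 0"
  shows "fh_inverse a N k l = rising_ratio (a + 1) k * rising_ratio (a + 1) l / fh_coeff a 0 *
    (\<Sum>m=max k l..N. rising_ratio a (m - k) * rising_ratio a (m - l) / rising_ratio (2 * a + 1) m)"
proof -
  have "fh_inverse a N k l = (\<Sum>m=max k l..N. fh_opoly a m k * fh_opoly a m l / fh_norm a m)"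
    unfolding fh_inverse_def by (rule sum.mono_neutral_right) (auto simp: fh_opoly_def)
  also have "\<dots> = (\<Sum>m=max k l..N. rising_ratio (a + 1) k * rising_ratio (a + 1) l / fh_coeff a 0 *
      (rising_ratio a (m - k) * rising_ratio a (m - l) / rising_ratio (2 * a + 1) m))"
  proof (intro sum.cong refl)
    fix m assume "m \<in> {max k l..N}"
    moreover have "rising_ratio (a + 1) m > 0" "fh_coeff a 0 > 0" using a by (auto intro: rising_ratio_pos fh_coeff_0_pos)
    ultimately show "fh_opoly a m k * fh_opoly a m l / fh_norm a m = rising_ratio (a + 1) k * rising_ratio (a + 1) l / fh_coeff a 0 *
      (rising_ratio a (m - k) * rising_ratio a (m - l) / rising_ratio (2 * a + 1) m)"
      by (simp add: fh_opoly_def fh_norm_def power2_eq_square)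
  qed
  finally show ?thesis by (simp add: sum_distrib_left)
qed


text \<open>The quotient \<open>u = (j + 1) / N\<close> lies between \<open>s\<close> and 2. The
  power \<open>a - 1\<close> is increasing or decreasing according to its sign, so one of the two
  summands dominates in either case.\<close>

lemma scaled_coeff_bound:
  assumes C: "\<And>n. rising_ratio a n \<le> C * real (n + 1) powr (a - 1)" "C > 0" and a: "a > 0"
    and s: "s > 0" and N: "N > 0" and j: "nat \<lfloor>real N * s\<rfloor> \<le> j" "j \<le> N"
  shows "\<bar>real N powr (1 - a) * rising_ratio a j\<bar> \<le> C * (2 powr (a - 1) + s powr (a - 1))"
proof -
  define u where "u = real (j + 1) / real N"
  have "real N * s \<le> real (j + 1)" using j(1) by linarith
  then have u: "s \<le> u" using N by (simp add: u_def field_simps)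
  have u2: "u \<le> 2" using j(2) N by (simp add: u_def field_simps)
  have "u powr (a - 1) \<le> 2 powr (a - 1) + s powr (a - 1)"
  proof (cases "a \<ge> 1")
    case True
    then have "u powr (a - 1) \<le> 2 powr (a - 1)" using u u2 s by (intro powr_mono2) auto
    then show ?thesis by (simp add: add_increasing2)
  next
    case False
    then have "u powr (a - 1) \<le> s powr (a - 1)" using u s by (intro powr_mono2') auto
    then show ?thesis by (simp add: add_increasing)
  qed
  have "real N powr (1 - a) * rising_ratio a j \<le> real N powr (1 - a) * (C * real (j + 1) powr (a - 1))"
    by (intro mult_left_mono C) auto
  also have "\<dots> = C * u powr (a - 1)"
    using N by (simp add: u_def powr_divide powr_diff field_simps)
  also have "\<dots> \<le> C * (2 powr (a - 1) + s powr (a - 1))"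
    using \<open>C > 0\<close> \<open>u powr (a - 1) \<le> _\<close> by (intro mult_left_mono) auto
  finally show ?thesis using rising_ratio_pos[OF a, of j] by (simp add: abs_mult)
qed

text \<open>The summation index is \<open>m = max k l + \<lfloor>N s\<rfloor>\<close>, so that the singularity sits at \<open>s = 0\<close> for every \<open>N\<close> and a
  single dominating function serves for dominated convergence.\<close>

lemma fh_inverse_scaled_eq_integral:
  assumes a: "a > 0" and N: "N > 0"
  shows "fh_inverse a N k l * real N powr (1 - 2 * a) =
    (rising_ratio (a + 1) k * real N powr (- a)) * (rising_ratio (a + 1) l * real N powr (- a)) / fh_coeff a 0 *
    integral {0..2} (\<lambda>s. (\<lambda>m. if m \<le> N then (real N powr (1 - a) * rising_ratio a (m - k)) * (real N powr (1 - a) * rising_ratio a (m - l))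
      * (real N powr (2 * a) / rising_ratio (2 * a + 1) m) else 0) (max k l + nat \<lfloor>real N * s\<rfloor>))"
    (is "_ = _ * integral _ (\<lambda>s. ?g (_ + _))")
    and "(\<lambda>s. (\<lambda>m. if m \<le> N then (real N powr (1 - a) * rising_ratio a (m - k)) * (real N powr (1 - a) * rising_ratio a (m - l))
      * (real N powr (2 * a) / rising_ratio (2 * a + 1) m) else 0) (max k l + nat \<lfloor>real N * s\<rfloor>)) integrable_on {0..2}"
proof -
  define p where "p = max k l"
  define f where "f = (\<lambda>m. rising_ratio a (m - k) * rising_ratio a (m - l) / rising_ratio (2 * a + 1) m)"
  \<comment> \<open>The index \<open>n = N\<close> occurs when \<open>p = 0\<close>, so
    \<open>N\<close> steps could be one too few; \<open>2 * N\<close> steps reach every nonzero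
    term.\<close>
  have I: "((\<lambda>s. ?g (p + nat \<lfloor>real N * s\<rfloor>)) has_integral (\<Sum>n<2*N. ?g (p + n)) / N) {0..2}"
    using has_integral_step[OF N, of "\<lambda>n. ?g (p + n)" "2 * N"] N by simp
  then show "(\<lambda>s. ?g (max k l + nat \<lfloor>real N * s\<rfloor>)) integrable_on {0..2}"
    unfolding p_def by (rule has_integral_integrable)
  have e: "real N powr (1 - a) * real N powr (1 - a) * real N powr (2 * a) = real N * real N"
    using N by (simp add: powr_add[symmetric] powr_diff powr_mult_base field_simps power2_eq_square)
  have "(\<Sum>n<2*N. ?g (p + n)) = (\<Sum>n<2*N. if p + n \<le> N then real N * real N * f (p + n) else 0)"
  proof (intro sum.cong refl)
    fix n
    have "(real N powr (1 - a) * rising_ratio a (p + n - k)) * (real N powr (1 - a) * rising_ratio a (p + n - l))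
      * (real N powr (2 * a) / rising_ratio (2 * a + 1) (p + n))
      = (real N powr (1 - a) * real N powr (1 - a) * real N powr (2 * a)) * f (p + n)" by (simp add: f_def)
    then show "?g (p + n) = (if p + n \<le> N then real N * real N * f (p + n) else 0)" unfolding e by simp
  qed
  also have "\<dots> = (\<Sum>n\<in>{n. p + n \<le> N}. real N * real N * f (p + n))"
    using N by (intro sum.mono_neutral_cong_right) auto
  also have "\<dots> = (\<Sum>m=p..N. real N * real N * f m)"
    by (rule sum.reindex_bij_witness[of _ "\<lambda>m. m - p" "\<lambda>n. p + n"]) auto
  finally have "(\<Sum>n<2*N. ?g (p + n)) / N = real N * (\<Sum>m=p..N. f m)"
    using N by (simp add: sum_distrib_left[symmetric])
  with I have J: "integral {0..2} (\<lambda>s. ?g (p + nat \<lfloor>real N * s\<rfloor>)) = real N * (\<Sum>m=p..N. f m)"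
    by (simp add: integral_unique)
  have e2: "real N powr (1 - 2 * a) = real N powr (- a) * real N powr (- a) * real N"
  proof -
    have "1 - 2 * a = - a + - a + 1" by simp
    then show ?thesis using N by (simp only: powr_add) simp
  qed
  show "fh_inverse a N k l * real N powr (1 - 2 * a) =
    (rising_ratio (a + 1) k * real N powr (- a)) * (rising_ratio (a + 1) l * real N powr (- a)) / fh_coeff a 0 *
    integral {0..2} (\<lambda>s. ?g (max k l + nat \<lfloor>real N * s\<rfloor>))"
    unfolding p_def[symmetric] J fh_inverse_eq[OF a] e2 f_def by simp
qed

text \<open>Dominated convergence for the step functions of
  \<open>fh_inverse_scaled_eq_integral\<close>. Orders and indices are arbitrary sequences, which is
  the form that uniformity later requires.\<close>

lemma fh_inverse_scaled_limit_aux: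
  fixes N k l :: "nat \<Rightarrow> nat"
  assumes a: "a > 1 / 2" and N: "filterlim N at_top sequentially" and Npos: "\<And>i. N i > 0"
    and k: "(\<lambda>i. real (k i) / real (N i)) \<longlonglongrightarrow> x" and l: "(\<lambda>i. real (l i) / real (N i)) \<longlonglongrightarrow> y"
    and x: "0 < x" "x < 1" and y: "0 < y" "y < 1"
  shows "(\<lambda>i. fh_inverse a (N i) (k i) (l i) * real (N i) powr (1 - 2 * a)) \<longlonglongrightarrow> G_kernel a x y / (Gamma a)\<^sup>2"
proof -
  define p where "p = (\<lambda>i. max (k i) (l i))"
  define z where "z = max x y"
  define g where "g = (\<lambda>i m. if m \<le> N i then (real (N i) powr (1 - a) * rising_ratio a (m - k i)) * (real (N i) powr (1 - a) * rising_ratio a (m - l i))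
      * (real (N i) powr (2 * a) / rising_ratio (2 * a + 1) m) else 0)"
  define h where "h = (\<lambda>i s. g i (p i + nat \<lfloor>real (N i) * s\<rfloor>))"
  define \<phi> where "\<phi> = (\<lambda>t. (t - x) powr (a - 1) * (t - y) powr (a - 1) / t powr (2 * a))"
  define c where "c = Gamma (2 * a + 1) / (Gamma a)\<^sup>2"
  define H where "H = (\<lambda>s. if z + s < 1 then c * \<phi> (z + s) else 0)"
  \<comment> \<open>At \<open>s = 1 - z\<close> the ratio \<open>m / N\<close> tends to 1 and the
    cut-off \<open>m \<le> N\<close> is undecided; at \<open>s = 0\<close> the limit factors may be
    singular. Such points form a null set.\<close>
  define S where "S = {0<..<2} - {1 - z}"
  have a0: "a > 0" using a by simp
  have z: "0 < z" "z < 1" "x \<le> z" "y \<le> z" using x y by (auto simp: z_def)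
  have neg: "negligible {s \<in> {0..2} - S. f s \<noteq> 0}" "negligible {s \<in> S - {0..2}. f s \<noteq> 0}" for f :: "real \<Rightarrow> real"
    by (rule negligible_subset[of "{0,2,1-z}"]; auto simp: S_def)+
  have pN: "(\<lambda>i. real (p i) / real (N i)) \<longlonglongrightarrow> z"
  proof -
    have "(\<lambda>i. max (real (k i) / real (N i)) (real (l i) / real (N i))) \<longlonglongrightarrow> z"
      unfolding z_def by (intro tendsto_max k l)
    moreover have "max (real (k i) / real (N i)) (real (l i) / real (N i)) = real (p i) / real (N i)" for i
      using Npos[of i] by (auto simp: p_def max_def divide_right_mono divide_le_cancel)
    ultimately show ?thesis by simp
  qed
  have A: "(\<lambda>n. rising_ratio (s + 1) n * real n powr (- s)) \<longlonglongrightarrow> 1 / Gamma (s + 1)" if "s > 0" for s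
    using rising_ratio_asymp[of "s + 1"] that by simp
  have W: "(\<lambda>i. real (N i) powr (2 * a) / rising_ratio (2 * a + 1) (j i)) \<longlonglongrightarrow> Gamma (2 * a + 1) / v powr (2 * a)"
    if "(\<lambda>i. real (j i) / real (N i)) \<longlonglongrightarrow> v" "v > 0" for j v
  proof -
    have "(\<lambda>i. inverse (rising_ratio (2 * a + 1) (j i) * real (N i) powr (- (2 * a)))) \<longlonglongrightarrow> inverse (1 / Gamma (2 * a + 1) * v powr (2 * a))"
    proof (intro tendsto_inverse scaled_asymp[OF N] A that)
      have "Gamma (2 * a + 1) > 0" using a0 by (intro Gamma_real_pos) auto
      then show "1 / Gamma (2 * a + 1) * v powr (2 * a) \<noteq> 0" using that by simp
    qed (use a0 in auto)
    then show ?thesis by (simp add: powr_minus field_simps)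
  qed
  obtain C where C: "C > 0" "\<And>n. rising_ratio a n \<le> C * real (n + 1) powr (a - 1)"
    using rising_ratio_bound[OF a0] by blast
  \<comment> \<open>Only the value at \<open>p i\<close> has to be bounded:
    \<open>rising_ratio (2 * a + 1)\<close> is increasing, so later terms are smaller.\<close>
  obtain D where D: "D > 0" "\<And>i. norm (real (N i) powr (2 * a) / rising_ratio (2 * a + 1) (p i)) \<le> D"
    using convergent_imp_Bseq[OF convergentI, OF W[OF pN z(1)]] by (auto elim: BseqE)
  define B where "B = (\<lambda>s::real. C\<^sup>2 * D * (2 * (2 powr (a - 1))\<^sup>2 + 2 * s powr (2 * a - 2)))"
  have conv: "(\<lambda>i. h i s) \<longlonglongrightarrow> H s" if s: "s \<in> S" for s
  proof -
    define m where "m = (\<lambda>i. p i + nat \<lfloor>real (N i) * s\<rfloor>)"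
    have "(\<lambda>i. real (p i) / real (N i) + real (nat \<lfloor>real (N i) * s\<rfloor>) / real (N i)) \<longlonglongrightarrow> z + s"
      using s by (intro tendsto_add pN tendsto_nat_floor_div N tendsto_const) (auto simp: S_def)
    then have m: "(\<lambda>i. real (m i) / real (N i)) \<longlonglongrightarrow> z + s" by (simp add: m_def add_divide_distrib)
    have hm: "h i s = g i (m i)" for i by (simp add: h_def m_def)
    have s0: "s > 0" "z + s \<noteq> 1" using s by (auto simp: S_def)
    show ?thesis
    proof (cases "z + s < 1")
      case True
      have "\<forall>\<^sub>F i in sequentially. real (m i) / real (N i) < 1" using order_tendstoD(2)[OF m True] .
      then have ev: "\<forall>\<^sub>F i in sequentially. (real (N i) powr (1 - a) * rising_ratio a (m i - k i)) * (real (N i) powr (1 - a) * rising_ratio a (m i - l i))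
          * (real (N i) powr (2 * a) / rising_ratio (2 * a + 1) (m i)) = h i s"
        by eventually_elim (use Npos in \<open>auto simp: hm g_def\<close>)
      have E: "(\<lambda>i. real (N i) powr (1 - a) * rising_ratio a (m i - q i)) \<longlonglongrightarrow> 1 / Gamma a * (z + s - w) powr (a - 1)"
        if q: "(\<lambda>i. real (q i) / real (N i)) \<longlonglongrightarrow> w" "\<And>i. q i \<le> p i" "w \<le> z" for q w
      proof -
        have "(\<lambda>i. real (m i) / real (N i) - real (q i) / real (N i)) \<longlonglongrightarrow> z + s - w"
          by (intro tendsto_diff m q)
        moreover have "q i \<le> m i" for i using q(2)[of i] by (simp add: m_def)
        ultimately have "(\<lambda>i. real (m i - q i) / real (N i)) \<longlonglongrightarrow> z + s - w"
          by (simp add: of_nat_diff diff_divide_distrib)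
        moreover have "(\<lambda>n. rising_ratio a n * real n powr (- (a - 1))) \<longlonglongrightarrow> 1 / Gamma a"
          using rising_ratio_asymp[OF a0] by simp
        ultimately have "(\<lambda>i. rising_ratio a (m i - q i) * real (N i) powr (- (a - 1))) \<longlonglongrightarrow> 1 / Gamma a * (z + s - w) powr (a - 1)"
          using q(3) s0 by (intro scaled_asymp[OF N]) auto
        then show ?thesis by (simp add: mult.commute)
      qed
      have "(\<lambda>i. (real (N i) powr (1 - a) * rising_ratio a (m i - k i)) * (real (N i) powr (1 - a) * rising_ratio a (m i - l i))
          * (real (N i) powr (2 * a) / rising_ratio (2 * a + 1) (m i))) \<longlonglongrightarrow>
          1 / Gamma a * (z + s - x) powr (a - 1) * (1 / Gamma a * (z + s - y) powr (a - 1)) * (Gamma (2 * a + 1) / (z + s) powr (2 * a))"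
        using z s0 by (intro tendsto_mult E W k l m) (auto simp: p_def)
      also have "1 / Gamma a * (z + s - x) powr (a - 1) * (1 / Gamma a * (z + s - y) powr (a - 1)) * (Gamma (2 * a + 1) / (z + s) powr (2 * a)) = H s"
        using True by (simp add: H_def c_def \<phi>_def power2_eq_square)
      finally show ?thesis using ev by (rule Lim_transform_eventually)
    next
      case False
      then have "z + s > 1" using s0 by simp
      then have "\<forall>\<^sub>F i in sequentially. real (m i) / real (N i) > 1" using order_tendstoD(1)[OF m] by blast
      then have "\<forall>\<^sub>F i in sequentially. 0 = h i s"
        by eventually_elim (use Npos in \<open>auto simp: hm g_def less_divide_eq\<close>)
      with tendsto_const[of "0::real"] have "(\<lambda>i. h i s) \<longlonglongrightarrow> 0" by (rule Lim_transform_eventually)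
      then show ?thesis using False by (simp add: H_def)
    qed
  qed
  have hint: "h i integrable_on {0..2}" for i
    using fh_inverse_scaled_eq_integral(2)[OF a0 Npos[of i], where k = "k i" and l = "l i"] unfolding h_def g_def p_def .
  have bound: "norm (h i s) \<le> B s" if s: "s \<in> S" for i s
  proof -
    define m where "m = p i + nat \<lfloor>real (N i) * s\<rfloor>"
    have s0: "s > 0" using s by (simp add: S_def)
    define E where "E = C * (2 powr (a - 1) + s powr (a - 1))"
    have E0: "E \<ge> 0" using C by (simp add: E_def)
    have EB: "E * E * D \<le> B s"
    proof -
      have "(2 powr (a - 1) + s powr (a - 1))\<^sup>2 \<le> 2 * (2 powr (a - 1))\<^sup>2 + 2 * (s powr (a - 1))\<^sup>2"
        using sum_squares_bound[of "2 powr (a - 1)" "s powr (a - 1)"] by (simp add: power2_sum)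
      also have "(s powr (a - 1))\<^sup>2 = s powr (2 * a - 2)"
        by (simp add: power2_eq_square powr_add[symmetric])
      finally have "C\<^sup>2 * D * (2 powr (a - 1) + s powr (a - 1))\<^sup>2 \<le> B s"
        unfolding B_def using C(1) D(1) by (intro mult_left_mono) auto
      then show ?thesis by (simp add: E_def power2_eq_square mult_ac)
    qed
    show ?thesis
    proof (cases "m \<le> N i")
      case True
      have "norm (h i s) = \<bar>real (N i) powr (1 - a) * rising_ratio a (m - k i)\<bar> * \<bar>real (N i) powr (1 - a) * rising_ratio a (m - l i)\<bar>
          * \<bar>real (N i) powr (2 * a) / rising_ratio (2 * a + 1) m\<bar>"
        using True by (simp add: h_def g_def m_def[symmetric] abs_mult)
      also have "\<dots> \<le> E * E * D"
      proof (intro mult_mono)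
        show "\<bar>real (N i) powr (1 - a) * rising_ratio a (m - k i)\<bar> \<le> E" "\<bar>real (N i) powr (1 - a) * rising_ratio a (m - l i)\<bar> \<le> E"
          unfolding E_def using True by (auto intro!: scaled_coeff_bound[OF C(2,1) a0 s0 Npos[of i]] simp: m_def p_def)
        have "real (N i) powr (2 * a) / rising_ratio (2 * a + 1) m \<le> real (N i) powr (2 * a) / rising_ratio (2 * a + 1) (p i)"
          using a0 by (intro divide_left_mono rising_ratio_mono mult_pos_pos rising_ratio_pos) (auto simp: m_def)
        moreover have "rising_ratio (2 * a + 1) m > 0" "rising_ratio (2 * a + 1) (p i) > 0"
          using a0 by (intro rising_ratio_pos; simp)+
        ultimately show "\<bar>real (N i) powr (2 * a) / rising_ratio (2 * a + 1) m\<bar> \<le> D"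
          using D(2)[of i] by simp
      qed (use E0 in auto)
      also have "\<dots> \<le> B s" by (rule EB)
      finally show ?thesis .
    next
      case False
      then show ?thesis using EB E0 D(1) by (simp add: h_def g_def m_def[symmetric]) (meson mult_nonneg_nonneg less_imp_le order_trans)
    qed
  qed
  \<comment> \<open>The exponent \<open>2 * a - 2\<close> exceeds \<open>-1\<close> precisely
    because \<open>a > 1 / 2\<close>.\<close>
  have Bint: "B integrable_on {0..2}"
    unfolding B_def using a by (intro integrable_on_mult_right integrable_add integrable_on_powr_from_0) auto
  have "H integrable_on S" and lim: "(\<lambda>i. integral S (h i)) \<longlonglongrightarrow> integral S H"
    by (rule dominated_convergence[OF integrable_spike_set[OF hint neg] integrable_spike_set[OF Bint neg] bound conv]; assumption)+
  then have HI: "(H has_integral integral S H) {0..2}"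
    using has_integral_spike_set_eq[OF neg] by blast
  have "((\<lambda>s. if s \<in> {0..1-z} then c * \<phi> (z + s) else 0) has_integral integral S H) {0..2}"
    by (rule has_integral_spike_finite[OF _ _ HI, of "{1 - z}"]) (auto simp: H_def)
  then have "((\<lambda>s. c * \<phi> (z + s)) has_integral integral S H) {0..1-z}"
    using z by (subst (asm) has_integral_restrict) auto
  then have "((\<lambda>t. c * \<phi> t) \<circ> (+) z has_integral integral S H) {0..1-z}"
    by (simp only: o_def)
  then have cI: "((\<lambda>t. c * \<phi> t) has_integral integral S H) {z..1}"
    by (simp add: has_integral_shift_Icc_real)
  have c: "c > 0"
    unfolding c_def using a0 by (intro divide_pos_pos zero_less_power Gamma_real_pos) auto
  then have \<phi>I: "(\<phi> has_integral integral S H / c) {z..1}"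
    using has_integral_mult_right[OF cI, of "1 / c"] by simp
  \<comment> \<open>Nonnegativity upgrades the gauge integral to the Lebesgue integral in which
    \<open>G_kernel\<close> is defined.\<close>
  then have "\<phi> absolutely_integrable_on {z..1}"
    using z by (intro nonnegative_absolutely_integrable_1) (auto simp: \<phi>_def)
  then have "set_lebesgue_integral lebesgue {z..1} \<phi> = integral {z..1} \<phi>"
    by (rule set_lebesgue_integral_eq_integral(2))
  then have G: "G_kernel a x y = x powr a * y powr a * (integral S H / c)"
    using \<phi>I by (simp add: G_kernel_def \<phi>_def z_def integral_unique)
  have "(\<lambda>i. (rising_ratio (a + 1) (k i) * real (N i) powr (- a)) * (rising_ratio (a + 1) (l i) * real (N i) powr (- a)) / fh_coeff a 0 * integral S (h i))
    \<longlonglongrightarrow> (1 / Gamma (a + 1) * x powr a) * (1 / Gamma (a + 1) * y powr a) / fh_coeff a 0 * integral S H"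
    using x y a0 fh_coeff_0_pos[OF a0] by (intro tendsto_mult tendsto_divide scaled_asymp[OF N] A k l lim tendsto_const) auto
  also have "(\<lambda>i. (rising_ratio (a + 1) (k i) * real (N i) powr (- a)) * (rising_ratio (a + 1) (l i) * real (N i) powr (- a)) / fh_coeff a 0 * integral S (h i))
    = (\<lambda>i. fh_inverse a (N i) (k i) (l i) * real (N i) powr (1 - 2 * a))"
  proof
    fix i
    have "integral S (h i) = integral {0..2} (h i)"
      by (rule integral_spike_set[OF neg(2,1)])
    then show "(rising_ratio (a + 1) (k i) * real (N i) powr (- a)) * (rising_ratio (a + 1) (l i) * real (N i) powr (- a)) / fh_coeff a 0 * integral S (h i)
      = fh_inverse a (N i) (k i) (l i) * real (N i) powr (1 - 2 * a)"
      using fh_inverse_scaled_eq_integral(1)[OF a0 Npos[of i], where k = "k i" and l = "l i"] by (simp only: h_def g_def p_def)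
  qed
  \<comment> \<open>The squares of \<open>Gamma (a + 1)\<close> cancel against
    \<open>fh_coeff a 0\<close>, and its \<open>Gamma (2 * a + 1)\<close> against the one in
    \<open>c\<close>, leaving the inverse square of \<open>Gamma a\<close>.\<close>
  also have "(1 / Gamma (a + 1) * x powr a) * (1 / Gamma (a + 1) * y powr a) / fh_coeff a 0 * integral S H = G_kernel a x y / (Gamma a)\<^sup>2"
  proof -
    have "Gamma (a + 1) > 0" "Gamma a > 0" "Gamma (2 * a + 1) > 0" using a0 by (auto intro!: Gamma_real_pos)
    then show ?thesis unfolding G fh_coeff_0[OF a0] c_def by (simp add: power2_eq_square)
  qed
  finally show ?thesis .
qed

lemma fh_inverse_scaled_limit:
  fixes N k l :: "nat \<Rightarrow> nat"
  assumes a: "a > 1 / 2" and N: "filterlim N at_top sequentially"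
    and k: "(\<lambda>i. real (k i) / real (N i)) \<longlonglongrightarrow> x" and l: "(\<lambda>i. real (l i) / real (N i)) \<longlonglongrightarrow> y"
    and x: "0 < x" "x < 1" and y: "0 < y" "y < 1"
  shows "(\<lambda>i. fh_inverse a (N i) (k i) (l i) * real (N i) powr (1 - 2 * a)) \<longlonglongrightarrow> G_kernel a x y / (Gamma a)\<^sup>2"
proof -
  define M where "M = (\<lambda>i. max 1 (N i))"
  have ev: "\<forall>\<^sub>F i in sequentially. N i = M i"
    using eventually_compose_filterlim[OF eventually_gt_at_top N, of 0] by eventually_elim (auto simp: M_def)
  have "(\<lambda>i. fh_inverse a (M i) (k i) (l i) * real (M i) powr (1 - 2 * a)) \<longlonglongrightarrow> G_kernel a x y / (Gamma a)\<^sup>2"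
  proof (rule fh_inverse_scaled_limit_aux[OF a _ _ _ _ x y])
    show "filterlim M at_top sequentially" using filterlim_cong[OF refl refl ev] N by simp
    show "(\<lambda>i. real (k i) / real (M i)) \<longlonglongrightarrow> x"
      by (rule Lim_transform_eventually[OF k eventually_mono[OF ev]]) simp
    show "(\<lambda>i. real (l i) / real (M i)) \<longlonglongrightarrow> y"
      by (rule Lim_transform_eventually[OF l eventually_mono[OF ev]]) simp
  qed (simp add: M_def)
  then show ?thesis
    by (rule Lim_transform_eventually[OF _ eventually_mono[OF ev]]) simp
qed

section \<open>Quadratic forms of Toeplitz matrices\<close>

text \<open>Frequencies are negated so that \<open>herm_form\<close> has the coefficient at
  \<open>l - k\<close> in position \<open>(k, l)\<close>, as \<open>toeplitz\<close> does.\<close>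

definition trig_poly :: "nat \<Rightarrow> (nat \<Rightarrow> complex) \<Rightarrow> real \<Rightarrow> complex" where
  "trig_poly N u \<theta> = (\<Sum>l\<le>N. u l * cis (- (real l * \<theta>)))"

text \<open>The sesquilinear form \<open>v* T u\<close> of the Toeplitz matrix \<open>T\<close> of
  \<open>H\<close>. As an integral it permits pointwise comparison of symbols.\<close>

definition herm_form :: "(real \<Rightarrow> real) \<Rightarrow> nat \<Rightarrow> (nat \<Rightarrow> complex) \<Rightarrow> (nat \<Rightarrow> complex) \<Rightarrow> complex" where
  "herm_form H N u v = integral {-pi..pi} (\<lambda>\<theta>. of_real (H \<theta>) * (trig_poly N u \<theta> * cnj (trig_poly N v \<theta>))) / of_real (2 * pi)"

definition energy :: "(real \<Rightarrow> real) \<Rightarrow> nat \<Rightarrow> (nat \<Rightarrow> complex) \<Rightarrow> real" where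
  "energy H N u = integral {-pi..pi} (\<lambda>\<theta>. H \<theta> * (cmod (trig_poly N u \<theta>))\<^sup>2) / (2 * pi)"

lemma continuous_on_trig_poly [continuous_intros]: "continuous_on S (trig_poly N u)"
  unfolding trig_poly_def by (intro continuous_intros)

lemma trig_poly_diff: "trig_poly N (\<lambda>j. u j - v j) \<theta> = trig_poly N u \<theta> - trig_poly N v \<theta>"
  by (simp add: trig_poly_def sum_subtractf algebra_simps)

lemma trig_poly_shift:
  "trig_poly (Suc N) (\<lambda>j. if j = 0 then 0 else u (j - 1)) \<theta> = cis (- \<theta>) * trig_poly N u \<theta>"
  unfolding trig_poly_def sum.atMost_Suc_shift
  by (simp add: sum_distrib_left mult_ac cis_mult algebra_simps)

lemma trig_poly_Suc: "u (Suc N) = 0 \<Longrightarrow> trig_poly (Suc N) u \<theta> = trig_poly N u \<theta>"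
  by (simp add: trig_poly_def)

lemma fourier_coeff_eq_integral:
  assumes "continuous_on {-pi..pi} (\<lambda>\<theta>. h (cis \<theta>))"
  shows "fourier_coeff h j = integral {-pi..pi} (\<lambda>\<theta>. h (cis \<theta>) * cis (- (of_int j * \<theta>))) / of_real (2 * pi)"
proof -
  have "(\<lambda>\<theta>. h (cis \<theta>) * cis (- (of_int j * \<theta>))) absolutely_integrable_on {-pi..pi}"
    by (intro absolutely_integrable_continuous_real continuous_intros assms)
  from set_lebesgue_integral_eq_integral(2)[OF this] show ?thesis
    by (simp add: fourier_coeff_def)
qed

lemma herm_form_eq_sum:
  assumes H: "continuous_on {-pi..pi} H"
  shows "herm_form H N u v = (\<Sum>k\<le>N. \<Sum>l\<le>N. cnj (v k) * u l *
    (integral {-pi..pi} (\<lambda>\<theta>. of_real (H \<theta>) * cis (- (of_int (int l - int k) * \<theta>))) / of_real (2 * pi)))"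
proof -
  have "(\<lambda>\<theta>. of_real (H \<theta>) * (trig_poly N u \<theta> * cnj (trig_poly N v \<theta>)))
     = (\<lambda>\<theta>. \<Sum>k\<le>N. \<Sum>l\<le>N. cnj (v k) * u l * (of_real (H \<theta>) * cis (- (of_int (int l - int k) * \<theta>))))"
  proof
    fix \<theta>
    have "of_real (H \<theta>) * (trig_poly N u \<theta> * cnj (trig_poly N v \<theta>))
      = (\<Sum>k\<le>N. \<Sum>l\<le>N. of_real (H \<theta>) * ((u l * cis (- (real l * \<theta>))) * cnj (v k * cis (- (real k * \<theta>)))))"
      by (simp add: trig_poly_def sum_distrib_left sum_distrib_right sum_product cnj_sum)
    also have "\<dots> = (\<Sum>k\<le>N. \<Sum>l\<le>N. cnj (v k) * u l * (of_real (H \<theta>) * cis (- (of_int (int l - int k) * \<theta>))))"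
    proof (intro sum.cong refl)
      fix k l :: nat
      have "cis (- (real l * \<theta>)) * cis (real k * \<theta>) = cis (- (of_int (int l - int k) * \<theta>))"
        by (simp add: cis_mult algebra_simps)
      then show "of_real (H \<theta>) * ((u l * cis (- (real l * \<theta>))) * cnj (v k * cis (- (real k * \<theta>))))
        = cnj (v k) * u l * (of_real (H \<theta>) * cis (- (of_int (int l - int k) * \<theta>)))"
        by (simp add: cis_cnj mult_ac)
    qed
    finally show "of_real (H \<theta>) * (trig_poly N u \<theta> * cnj (trig_poly N v \<theta>))
      = (\<Sum>k\<le>N. \<Sum>l\<le>N. cnj (v k) * u l * (of_real (H \<theta>) * cis (- (of_int (int l - int k) * \<theta>))))" .
  qed
  moreover have "(\<lambda>\<theta>. cnj (v k) * u l * (of_real (H \<theta>) * cis (- (of_int (int l - int k) * \<theta>)))) integrable_on {-pi..pi}" for k l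
    using H by (intro integrable_continuous_interval continuous_intros)
  ultimately show ?thesis
    by (simp add: herm_form_def Henstock_Kurzweil_Integration.integral_sum integrable_sum sum_divide_distrib)
qed

lemma energy_has_integral:
  assumes "continuous_on {-pi..pi} H"
  shows "((\<lambda>\<theta>. H \<theta> * (cmod (trig_poly N u \<theta>))\<^sup>2) has_integral 2 * pi * energy H N u) {-pi..pi}"
proof -
  have "(\<lambda>\<theta>. H \<theta> * (cmod (trig_poly N u \<theta>))\<^sup>2) integrable_on {-pi..pi}"
    using assms by (intro integrable_continuous_interval continuous_intros)
  then show ?thesis by (simp add: energy_def has_integral_integral)
qed

lemma herm_form_has_integral:
  assumes "continuous_on {-pi..pi} H"
  shows "((\<lambda>\<theta>. of_real (H \<theta>) * (trig_poly N u \<theta> * cnj (trig_poly N v \<theta>))) has_integral of_real (2 * pi) * herm_form H N u v) {-pi..pi}"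
proof -
  have "(\<lambda>\<theta>. of_real (H \<theta>) * (trig_poly N u \<theta> * cnj (trig_poly N v \<theta>))) integrable_on {-pi..pi}"
    using assms by (intro integrable_continuous_interval continuous_intros)
  then show ?thesis by (simp add: herm_form_def has_integral_integral)
qed

lemma herm_form_self:
  assumes "continuous_on {-pi..pi} H"
  shows "herm_form H N u u = of_real (energy H N u)"
proof -
  have "((\<lambda>\<theta>. of_real (H \<theta> * (cmod (trig_poly N u \<theta>))\<^sup>2)) has_integral complex_of_real (2 * pi * energy H N u)) {-pi..pi}"
    by (rule has_integral_of_real[OF energy_has_integral[OF assms]])
  also have "(\<lambda>\<theta>. complex_of_real (H \<theta> * (cmod (trig_poly N u \<theta>))\<^sup>2)) = (\<lambda>\<theta>. of_real (H \<theta>) * (trig_poly N u \<theta> * cnj (trig_poly N u \<theta>)))"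
    by (simp only: of_real_mult complex_norm_square)
  finally have "of_real (2 * pi) * herm_form H N u u = complex_of_real (2 * pi * energy H N u)"
    using herm_form_has_integral[OF assms] has_integral_unique by blast
  then show ?thesis by simp
qed

lemma energy_nonneg:
  assumes "continuous_on {-pi..pi} H" "\<And>\<theta>. \<theta> \<in> {-pi..pi} \<Longrightarrow> H \<theta> \<ge> 0"
  shows "energy H N u \<ge> 0"
  unfolding energy_def using assms
  by (intro divide_nonneg_nonneg Henstock_Kurzweil_Integration.integral_nonneg integrable_continuous_interval continuous_intros) auto

lemma energy_diff:
  assumes "continuous_on {-pi..pi} H"
  shows "energy H N (\<lambda>j. u j - v j) = energy H N u + energy H N v - 2 * Re (herm_form H N u v)"
proof -
  have "((\<lambda>\<theta>. H \<theta> * (cmod (trig_poly N u \<theta>))\<^sup>2 + H \<theta> * (cmod (trig_poly N v \<theta>))\<^sup>2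
      - 2 * Re (of_real (H \<theta>) * (trig_poly N u \<theta> * cnj (trig_poly N v \<theta>)))) has_integral
      2 * pi * energy H N u + 2 * pi * energy H N v - 2 * Re (of_real (2 * pi) * herm_form H N u v)) {-pi..pi}"
    by (intro has_integral_diff has_integral_add has_integral_mult_right energy_has_integral assms
        has_integral_Re herm_form_has_integral)
  also have "(\<lambda>\<theta>. H \<theta> * (cmod (trig_poly N u \<theta>))\<^sup>2 + H \<theta> * (cmod (trig_poly N v \<theta>))\<^sup>2
      - 2 * Re (of_real (H \<theta>) * (trig_poly N u \<theta> * cnj (trig_poly N v \<theta>))))
      = (\<lambda>\<theta>. H \<theta> * (cmod (trig_poly N (\<lambda>j. u j - v j) \<theta>))\<^sup>2)"
  proof
    fix \<theta>
    have *: "(cmod (p - q))\<^sup>2 = (cmod p)\<^sup>2 + (cmod q)\<^sup>2 - 2 * Re (p * cnj q)" for p q :: complex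
      unfolding cmod_power2 by (simp add: power2_eq_square algebra_simps)
    show "H \<theta> * (cmod (trig_poly N u \<theta>))\<^sup>2 + H \<theta> * (cmod (trig_poly N v \<theta>))\<^sup>2
      - 2 * Re (of_real (H \<theta>) * (trig_poly N u \<theta> * cnj (trig_poly N v \<theta>)))
      = H \<theta> * (cmod (trig_poly N (\<lambda>j. u j - v j) \<theta>))\<^sup>2"
      unfolding trig_poly_diff * by (simp add: algebra_simps)
  qed
  finally have "2 * pi * energy H N (\<lambda>j. u j - v j)
      = 2 * pi * energy H N u + 2 * pi * energy H N v - 2 * Re (of_real (2 * pi) * herm_form H N u v)"
    using energy_has_integral[OF assms] has_integral_unique by blast
  also have "\<dots> = 2 * pi * (energy H N u + energy H N v - 2 * Re (herm_form H N u v))"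
    by (simp add: algebra_simps)
  finally show ?thesis by simp
qed

section \<open>Reproducing property of the columns of the pure inverse\<close>

definition fh_col :: "real \<Rightarrow> nat \<Rightarrow> nat \<Rightarrow> nat \<Rightarrow> complex" where
  "fh_col a N l = (\<lambda>k. of_real (fh_inverse a N k l))"

text \<open>The reproducing property: a column of the inverse, moved through the form, becomes a
  unit vector.\<close>

lemma herm_form_fh_col:
  assumes a: "a > 0" and l: "l \<le> N"
  shows "herm_form (fh_weight a) N u (fh_col a N l) = u l"
proof -
  have "herm_form (fh_weight a) N u (fh_col a N l) =
    (\<Sum>k\<le>N. \<Sum>j\<le>N. u j * of_real (fh_inverse a N k l * fh_coeff a (int j - int k)))"
    unfolding herm_form_eq_sum[OF continuous_on_fh_weight[OF a]] integral_fh_weight_cis[OF a]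
    by (simp add: fh_col_def mult_ac)
  also have "\<dots> = (\<Sum>j\<le>N. \<Sum>k\<le>N. u j * of_real (fh_inverse a N k l * fh_coeff a (int j - int k)))"
    by (rule sum.swap)
  also have "\<dots> = (\<Sum>j\<le>N. u j * of_real (if j = l then 1 else 0))"
    by (intro sum.cong refl) (simp only: sum_distrib_left[symmetric] of_real_sum[symmetric] fh_inverse_toeplitz[OF a l] atMost_iff)
  also have "\<dots> = (\<Sum>j\<in>{l}. u j * of_real (if j = l then 1 else 0))"
    using l by (intro sum.mono_neutral_right) auto
  finally show ?thesis by simp
qed

lemma energy_fh_col:
  assumes "a > 0" "l \<le> N"
  shows "energy (fh_weight a) N (fh_col a N l) = fh_inverse a N l l"
proof -
  have "complex_of_real (energy (fh_weight a) N (fh_col a N l)) = of_real (fh_inverse a N l l)"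
    using herm_form_fh_col[OF assms] herm_form_self[OF continuous_on_fh_weight[OF assms(1)]]
    by (metis fh_col_def)
  then show ?thesis by (simp only: of_real_eq_iff)
qed

text \<open>The cross term is a coefficient of \<open>g\<close> by the reproducing property. When
  \<open>g\<close> comes from a column too, distances in energy become combinations of matrix
  entries.\<close>

lemma energy_fh_col_diff:
  assumes "a > 0" "l \<le> N"
  shows "energy (fh_weight a) N (\<lambda>j. g j - fh_col a N l j) = energy (fh_weight a) N g + fh_inverse a N l l - 2 * Re (g l)"
  using assms by (simp add: energy_diff continuous_on_fh_weight herm_form_fh_col energy_fh_col)

lemma has_integral_norm_le:
  fixes f :: "'a::euclidean_space \<Rightarrow> 'b::banach"
  assumes "(f has_integral I) S" "(g has_integral J) S" "\<And>x. x \<in> S \<Longrightarrow> norm (f x) \<le> g x"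
  shows "norm I \<le> J"
  using Henstock_Kurzweil_Integration.integral_norm_bound_integral[of f S g] assms
  by (auto simp: has_integral_integrable_integral)

text \<open>Cauchy-Schwarz combined with the weighted arithmetic-geometric inequality; the free
  parameter \<open>t\<close> avoids square roots.\<close>

lemma norm_herm_form_le:
  assumes H: "continuous_on {-pi..pi} H" "\<And>\<theta>. \<theta> \<in> {-pi..pi} \<Longrightarrow> H \<theta> \<ge> 0" and t: "t > 0"
  shows "cmod (herm_form H N u v) \<le> (t * energy H N u + energy H N v / t) / 2"
proof -
  have 1: "((\<lambda>\<theta>. t / 2 * (H \<theta> * (cmod (trig_poly N u \<theta>))\<^sup>2) + 1 / (2 * t) * (H \<theta> * (cmod (trig_poly N v \<theta>))\<^sup>2))
     has_integral t / 2 * (2 * pi * energy H N u) + 1 / (2 * t) * (2 * pi * energy H N v)) {-pi..pi}"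
    by (intro has_integral_add has_integral_mult_right energy_has_integral H)
  have "cmod (of_real (2 * pi) * herm_form H N u v) \<le> t / 2 * (2 * pi * energy H N u) + 1 / (2 * t) * (2 * pi * energy H N v)"
  proof (rule has_integral_norm_le[OF herm_form_has_integral[OF H(1)] 1])
    fix \<theta> assume "\<theta> \<in> {-pi..pi}"
    then have H0: "H \<theta> \<ge> 0" by (rule H)
    define p q where "p = cmod (trig_poly N u \<theta>)" and "q = cmod (trig_poly N v \<theta>)"
    have "p * q \<le> t / 2 * p\<^sup>2 + 1 / (2 * t) * q\<^sup>2"
    proof -
      have "0 \<le> (t * p - q)\<^sup>2 / (2 * t)" using t by simp
      also have "\<dots> = t / 2 * p\<^sup>2 + 1 / (2 * t) * q\<^sup>2 - p * q"
        using t by (simp add: power2_eq_square field_simps)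
      finally show ?thesis by simp
    qed
    then have "H \<theta> * (p * q) \<le> H \<theta> * (t / 2 * p\<^sup>2 + 1 / (2 * t) * q\<^sup>2)"
      by (rule mult_left_mono[OF _ H0])
    then show "norm (of_real (H \<theta>) * (trig_poly N u \<theta> * cnj (trig_poly N v \<theta>)))
       \<le> t / 2 * (H \<theta> * (cmod (trig_poly N u \<theta>))\<^sup>2) + 1 / (2 * t) * (H \<theta> * (cmod (trig_poly N v \<theta>))\<^sup>2)"
      using H0 by (simp add: norm_mult p_def q_def algebra_simps)
  qed
  then have "2 * pi * cmod (herm_form H N u v) \<le> 2 * pi * ((t * energy H N u + energy H N v / t) / 2)"
    using t by (simp add: norm_mult field_simps)
  then show ?thesis by simp
qed


lemma herm_form_toeplitz:
  assumes h: "\<And>\<theta>. h (cis \<theta>) = of_real (H \<theta>)" and H: "continuous_on {-pi..pi} H"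
    and u: "\<And>k. k \<le> N \<Longrightarrow> (\<Sum>l\<le>N. fourier_coeff h (int l - int k) * u l) = e k"
  shows "herm_form H N u v = (\<Sum>k\<le>N. cnj (v k) * e k)"
proof -
  have "continuous_on {-pi..pi} (\<lambda>\<theta>. h (cis \<theta>))"
    unfolding h using H by (intro continuous_intros)
  from fourier_coeff_eq_integral[OF this] have fc: "fourier_coeff h j = integral {-pi..pi} (\<lambda>\<theta>. of_real (H \<theta>) * cis (- (of_int j * \<theta>))) / of_real (2 * pi)" for j
    by (simp only: h)
  have "herm_form H N u v = (\<Sum>k\<le>N. \<Sum>l\<le>N. cnj (v k) * u l * fourier_coeff h (int l - int k))"
    unfolding herm_form_eq_sum[OF H] fc ..
  also have "\<dots> = (\<Sum>k\<le>N. cnj (v k) * (\<Sum>l\<le>N. fourier_coeff h (int l - int k) * u l))"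
    by (simp add: sum_distrib_left mult_ac)
  also have "\<dots> = (\<Sum>k\<le>N. cnj (v k) * e k)"
    using u by (intro sum.cong) auto
  finally show ?thesis .
qed

lemma energy_mono:
  assumes "continuous_on {-pi..pi} H" "continuous_on {-pi..pi} H'" "\<And>\<theta>. \<theta> \<in> {-pi..pi} \<Longrightarrow> m * H \<theta> \<le> H' \<theta>"
  shows "m * energy H N u \<le> energy H' N u"
proof -
  have "m * (2 * pi * energy H N u) \<le> 2 * pi * energy H' N u"
  proof (rule has_integral_le)
    show "((\<lambda>\<theta>. m * (H \<theta> * (cmod (trig_poly N u \<theta>))\<^sup>2)) has_integral m * (2 * pi * energy H N u)) {-pi..pi}"
      by (intro has_integral_mult_right energy_has_integral assms)
    show "((\<lambda>\<theta>. H' \<theta> * (cmod (trig_poly N u \<theta>))\<^sup>2) has_integral 2 * pi * energy H' N u) {-pi..pi}"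
      by (intro energy_has_integral assms)
  next
    fix \<theta> assume "\<theta> \<in> {-pi..pi}"
    from mult_right_mono[OF assms(3)[OF this], of "(cmod (trig_poly N u \<theta>))\<^sup>2"]
    show "m * (H \<theta> * (cmod (trig_poly N u \<theta>))\<^sup>2) \<le> H' \<theta> * (cmod (trig_poly N u \<theta>))\<^sup>2" by (simp add: mult_ac)
  qed
  then have "2 * pi * (m * energy H N u) \<le> 2 * pi * energy H' N u" by (simp add: mult_ac)
  then show ?thesis by simp
qed

section \<open>Comparison with the pure symbol\<close>

text \<open>Here \<open>e1\<close> and \<open>e2\<close> are the energies of the differences between the column \<open>V\<close> of \<open>K\<^sub>N\<close> and, respectively, the
  column \<open>V'\<close> of \<open>K\<^sub>N\<^sub>-\<^sub>1\<close> and the shift \<open>S\<close> of \<open>V'\<close>. Since \<open>|V' - S| = |1 - \<chi>| |V'|\<close>, they control the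
  energy of \<open>V\<close> on \<open>|1 - \<chi>| \<ge> \<eta>\<close>.\<close>

lemma toeplitz_inverse_compare:
  fixes F :: "real \<Rightarrow> real"
  assumes a: "a > 0" and F: "continuous_on {-pi..pi} F"
    and m: "m > 0" "\<And>\<theta>. \<theta> \<in> {-pi..pi} \<Longrightarrow> m \<le> F \<theta>" "m \<le> c"
    and M: "\<And>\<theta>. \<theta> \<in> {-pi..pi} \<Longrightarrow> F \<theta> \<le> M" "c \<le> M"
    and pos: "\<eta> > 0" "\<tau> > 0" "\<epsilon> \<ge> 0"
    and near: "\<And>\<theta>. \<theta> \<in> {-pi..pi} \<Longrightarrow> cmod (1 - cis \<theta>) < \<eta> \<Longrightarrow> \<bar>F \<theta> - c\<bar> \<le> \<epsilon>"
    and h: "\<And>\<theta>. h (cis \<theta>) = of_real (fh_weight a \<theta> * F \<theta>)"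
    and u: "\<And>k. k \<le> N \<Longrightarrow> (\<Sum>l\<le>N. fourier_coeff h (int l - int k) * u l) = (if k = l0 then 1 else 0)"
    and N: "N = Suc N'" and l0: "l0 \<le> N" and k: "1 \<le> k" "k \<le> N'"
    and e1: "e1 = fh_inverse a N k k - fh_inverse a N' k k"
    and e2: "e2 = fh_inverse a N k k - 2 * fh_inverse a N' (k - 1) k + fh_inverse a N' k k"
  shows "cmod (of_real c * u k - of_real (fh_inverse a N k l0)) \<le>
    (\<epsilon> + M * \<tau>) / 2 * (fh_inverse a N l0 l0 / m\<^sup>2) + \<epsilon> / 2 * fh_inverse a N k k
    + M / (2 * \<tau>) * (2 * e1 + 4 / \<eta>\<^sup>2 * (e1 + e2))"
proof -
  define W where "W = fh_weight a"
  define H where "H = (\<lambda>\<theta>. W \<theta> * F \<theta>)"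
  define v where "v = fh_col a N k"
  define v' where "v' = fh_col a N' k"
  define sv where "sv = (\<lambda>j. if j = 0 then 0 else v' (j - 1))"
  have W: "continuous_on {-pi..pi} W" "W \<theta> \<ge> 0" for \<theta>
    using a by (auto simp: W_def fh_weight_nonneg intro: continuous_on_fh_weight)
  have H: "continuous_on {-pi..pi} H" unfolding H_def by (intro continuous_intros W F)
  have mH: "m * W \<theta> \<le> H \<theta>" if "\<theta> \<in> {-pi..pi}" for \<theta>
    using mult_right_mono[OF m(2)[OF that] W(2)[of \<theta>]] by (simp add: H_def mult.commute)
  have H0: "H \<theta> \<ge> 0" if "\<theta> \<in> {-pi..pi}" for \<theta>
    using m(1) m(2)[OF that] W(2)[of \<theta>] by (simp add: H_def)
  have kN: "k \<le> N" using k N by simp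
  \<comment> \<open>\<open>u\<close> is a column of the inverse for the full symbol and so
    reproduces coefficients in the full form. The conjugate appears because \<open>u\<close> stands
    in the linear slot.\<close>
  have form: "herm_form H N u w = cnj (w l0)" for w
  proof -
    have "herm_form H N u w = (\<Sum>k\<le>N. cnj (w k) * (if k = l0 then 1 else 0))"
      by (rule herm_form_toeplitz[OF _ H u]) (simp_all add: h H_def W_def)
    also have "\<dots> = (\<Sum>k\<in>{l0}. cnj (w k) * (if k = l0 then 1 else 0))"
      using l0 by (intro sum.mono_neutral_right) auto
    finally show ?thesis by simp
  qed

  define E where "E = energy W N u"
  have Ebound: "E \<le> fh_inverse a N l0 l0 / m\<^sup>2"
  proof -
    define R where "R = energy H N u"
    have "of_real R = cnj (u l0)" using form[of u] herm_form_self[OF H, of N u] by (simp add: R_def)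
    then have "cmod (u l0) = \<bar>R\<bar>" by (metis complex_mod_cnj norm_of_real)
    \<comment> \<open>The pure form with column \<open>l0\<close> also reads off
      \<open>u l0\<close>, whose modulus is \<open>R\<close> up to sign. With \<open>t = m\<close>
      and \<open>m * E \<le> R\<close> this yields \<open>R \<le> (R + K / m) / 2\<close>, where
      \<open>K\<close> is the diagonal entry; hence
      \<open>m * E \<le> R \<le> K / m\<close>.\<close>
    moreover have "cmod (herm_form W N u (fh_col a N l0)) \<le> (m * energy W N u + energy W N (fh_col a N l0) / m) / 2"
      by (rule norm_herm_form_le) (use W m in auto)
    moreover have mE: "m * E \<le> R" unfolding E_def R_def by (rule energy_mono[OF W(1) H mH])
    ultimately have "R \<le> (R + fh_inverse a N l0 l0 / m) / 2"
      using a l0 by (simp add: W_def herm_form_fh_col energy_fh_col E_def)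
    then have "m * E \<le> fh_inverse a N l0 l0 / m" using mE by simp
    then show ?thesis using m(1) by (simp add: power2_eq_square field_simps)
  qed
  have Ev: "energy W N v = fh_inverse a N k k"
    unfolding W_def v_def by (rule energy_fh_col[OF a kN])
  have tv': "trig_poly N v' \<theta> = trig_poly N' v' \<theta>" for \<theta>
    unfolding N by (rule trig_poly_Suc) (simp add: v'_def fh_col_def fh_inverse_eq_0)
  have tsv: "trig_poly N sv \<theta> = cis (- \<theta>) * trig_poly N v' \<theta>" for \<theta>
    unfolding tv' unfolding N sv_def by (rule trig_poly_shift)
  have Ev': "energy W N v' = fh_inverse a N' k k"
    using energy_fh_col[OF a k(2)] by (simp add: energy_def tv') (simp add: v'_def W_def)
  have Esv: "energy W N sv = fh_inverse a N' k k"
    unfolding Ev'[symmetric] energy_def tsv by (simp add: norm_mult)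
  have E1: "energy W N (\<lambda>j. v' j - v j) = e1"
    using energy_fh_col_diff[OF a kN, of v'] Ev' unfolding v_def[symmetric] W_def[symmetric] e1
    by (simp add: v'_def fh_col_def)
  \<comment> \<open>Coefficient \<open>k\<close> of the shift is entry \<open>k - 1\<close> of the
    column of order \<open>N'\<close>; this explains the row index in \<open>e2\<close> and the
    assumption \<open>1 \<le> k\<close>.\<close>
  have E2: "energy W N (\<lambda>j. sv j - v j) = e2"
    using energy_fh_col_diff[OF a kN, of sv] Esv k unfolding v_def[symmetric] W_def[symmetric] e2
    by (simp add: sv_def v'_def fh_col_def)

  \<comment> \<open>One majorant serves both regions, so no integral has to be split at
    \<open>\<eta>\<close>. The terms with \<open>\<epsilon>\<close> pay for the region near 0, those
    with \<open>M\<close> for the rest.\<close>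
  define B where "B = (\<lambda>\<theta>. (\<epsilon> + M * \<tau>) / 2 * (W \<theta> * (cmod (trig_poly N u \<theta>))\<^sup>2) + \<epsilon> / 2 * (W \<theta> * (cmod (trig_poly N v \<theta>))\<^sup>2)
    + M / (2 * \<tau>) * (2 * (W \<theta> * (cmod (trig_poly N (\<lambda>j. v' j - v j) \<theta>))\<^sup>2) + 4 / \<eta>\<^sup>2 * (W \<theta> * (cmod (trig_poly N (\<lambda>j. v' j - v j) \<theta>))\<^sup>2
      + W \<theta> * (cmod (trig_poly N (\<lambda>j. sv j - v j) \<theta>))\<^sup>2)))"
  have BI: "(B has_integral ((\<epsilon> + M * \<tau>) / 2 * (2 * pi * E) + \<epsilon> / 2 * (2 * pi * fh_inverse a N k k)
    + M / (2 * \<tau>) * (2 * (2 * pi * e1) + 4 / \<eta>\<^sup>2 * (2 * pi * e1 + 2 * pi * e2)))) {-pi..pi}"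
    unfolding B_def E_def Ev[symmetric] E1[symmetric] E2[symmetric]
    by (intro has_integral_add has_integral_mult_right energy_has_integral W)
  have FI: "((\<lambda>\<theta>. of_real c * (of_real (W \<theta>) * (trig_poly N u \<theta> * cnj (trig_poly N v \<theta>))) - of_real (H \<theta>) * (trig_poly N u \<theta> * cnj (trig_poly N v \<theta>)))
      has_integral of_real c * (of_real (2 * pi) * herm_form W N u v) - of_real (2 * pi) * herm_form H N u v) {-pi..pi}"
    by (intro has_integral_diff has_integral_mult_right herm_form_has_integral W H)
  have FB: "norm (of_real c * (of_real (W \<theta>) * (trig_poly N u \<theta> * cnj (trig_poly N v \<theta>))) - of_real (H \<theta>) * (trig_poly N u \<theta> * cnj (trig_poly N v \<theta>))) \<le> B \<theta>"
    if \<theta>: "\<theta> \<in> {-pi..pi}" for \<theta>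
  proof -
    define U V V' S where "U = trig_poly N u \<theta>" and "V = trig_poly N v \<theta>" and "V' = trig_poly N v' \<theta>" and "S = trig_poly N sv \<theta>"
    \<comment> \<open>Upper bound for the squared modulus of \<open>V\<close> away from 0. The
      inequality \<open>sq\<close> is used twice: for \<open>V = (V - V') + V'\<close>, and for
      \<open>V' - S = (V' - V) + (V - S)\<close> after division by the square of
      \<open>\<eta>\<close>; this yields the constants 2 and 4.\<close>
    define D where "D = 2 * (cmod (V' - V))\<^sup>2 + 4 / \<eta>\<^sup>2 * ((cmod (V' - V))\<^sup>2 + (cmod (S - V))\<^sup>2)"
    have D0: "D \<ge> 0" by (simp add: D_def)
    have M0: "M \<ge> 0" using m M by linarith
    have B: "B \<theta> = W \<theta> * ((\<epsilon> + M * \<tau>) / 2 * (cmod U)\<^sup>2 + \<epsilon> / 2 * (cmod V)\<^sup>2 + M / (2 * \<tau>) * D)"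
      by (simp add: B_def trig_poly_diff U_def V_def V'_def S_def D_def algebra_simps)
    have sq: "(cmod (p + q))\<^sup>2 \<le> 2 * (cmod p)\<^sup>2 + 2 * (cmod q)\<^sup>2" for p q :: complex
    proof -
      have "(cmod (p + q))\<^sup>2 \<le> (cmod p + cmod q)\<^sup>2" by (intro power_mono norm_triangle_ineq) auto
      also have "\<dots> \<le> 2 * (cmod p)\<^sup>2 + 2 * (cmod q)\<^sup>2"
        using sum_squares_bound[of "cmod p" "cmod q"] by (simp add: power2_sum)
      finally show ?thesis .
    qed
    have "norm (of_real c * (of_real (W \<theta>) * (U * cnj V)) - of_real (H \<theta>) * (U * cnj V)) = W \<theta> * (\<bar>F \<theta> - c\<bar> * (cmod U * cmod V))"
    proof -
      have "of_real c * (of_real (W \<theta>) * (U * cnj V)) - of_real (H \<theta>) * (U * cnj V) = of_real (W \<theta>) * (of_real (c - F \<theta>) * (U * cnj V))"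
        by (simp add: H_def algebra_simps)
      then show ?thesis using W(2)[of \<theta>] by (simp only: norm_mult norm_of_real complex_mod_cnj abs_of_nonneg abs_minus_commute)
    qed
    also have "\<dots> \<le> W \<theta> * ((\<epsilon> + M * \<tau>) / 2 * (cmod U)\<^sup>2 + \<epsilon> / 2 * (cmod V)\<^sup>2 + M / (2 * \<tau>) * D)"
    proof (rule mult_left_mono[OF _ W(2)])
      show "\<bar>F \<theta> - c\<bar> * (cmod U * cmod V) \<le> (\<epsilon> + M * \<tau>) / 2 * (cmod U)\<^sup>2 + \<epsilon> / 2 * (cmod V)\<^sup>2 + M / (2 * \<tau>) * D"
      proof (cases "cmod (1 - cis \<theta>) < \<eta>")
        case True
        have "\<bar>F \<theta> - c\<bar> * (cmod U * cmod V) \<le> \<epsilon> * (cmod U * cmod V)"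
          by (rule mult_right_mono[OF near[OF \<theta> True]]) simp
        also have "cmod U * cmod V \<le> ((cmod U)\<^sup>2 + (cmod V)\<^sup>2) / 2"
          using sum_squares_bound[of "cmod U" "cmod V"] by simp
        then have "\<epsilon> * (cmod U * cmod V) \<le> \<epsilon> * (((cmod U)\<^sup>2 + (cmod V)\<^sup>2) / 2)"
          by (rule mult_left_mono) (rule pos)
        also have "\<dots> \<le> (\<epsilon> + M * \<tau>) / 2 * (cmod U)\<^sup>2 + \<epsilon> / 2 * (cmod V)\<^sup>2"
          using M0 pos by (simp add: field_simps)
        also have "\<dots> \<le> (\<epsilon> + M * \<tau>) / 2 * (cmod U)\<^sup>2 + \<epsilon> / 2 * (cmod V)\<^sup>2 + M / (2 * \<tau>) * D"
          using M0 pos D0 by simp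
        finally show ?thesis .
      next
        case False
        have far: "\<eta>\<^sup>2 \<le> (cmod (1 - cis (- \<theta>)))\<^sup>2"
        proof -
          have "cmod (1 - cis (- \<theta>)) = cmod (1 - cis \<theta>)"
            by (metis cis_cnj complex_cnj_diff complex_cnj_one complex_mod_cnj)
          then show ?thesis using False pos(1) by (intro power_mono) auto
        qed
        have "\<eta>\<^sup>2 * (cmod V')\<^sup>2 \<le> (cmod (1 - cis (- \<theta>)))\<^sup>2 * (cmod V')\<^sup>2"
          by (rule mult_right_mono[OF far]) simp
        also have "\<dots> = (cmod ((V' - V) + (V - S)))\<^sup>2"
          unfolding S_def tsv V'_def[symmetric] power_mult_distrib[symmetric] norm_mult[symmetric] by (simp add: algebra_simps)
        also have "\<dots> \<le> 2 * (cmod (V' - V))\<^sup>2 + 2 * (cmod (V - S))\<^sup>2" by (rule sq)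
        finally have V': "(cmod V')\<^sup>2 \<le> (2 * (cmod (V' - V))\<^sup>2 + 2 * (cmod (S - V))\<^sup>2) / \<eta>\<^sup>2"
          using pos(1) by (simp add: norm_minus_commute[of V S] field_simps)
        have "(cmod V)\<^sup>2 \<le> 2 * (cmod (V - V'))\<^sup>2 + 2 * (cmod V')\<^sup>2"
          using sq[of "V - V'" V'] by simp
        also have "\<dots> \<le> D" unfolding D_def using V' by (simp add: norm_minus_commute[of V V'] algebra_simps add_divide_distrib)
        finally have VD: "(cmod V)\<^sup>2 \<le> D" .
        have "\<bar>F \<theta> - c\<bar> \<le> M" using m(1) m(2)[OF \<theta>] m(3) M(1)[OF \<theta>] M(2) by linarith
        then have "\<bar>F \<theta> - c\<bar> * (cmod U * cmod V) \<le> M * (cmod U * cmod V)"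
          by (rule mult_right_mono) simp
        also have "cmod U * cmod V \<le> \<tau> / 2 * (cmod U)\<^sup>2 + 1 / (2 * \<tau>) * (cmod V)\<^sup>2"
        proof -
          have "0 \<le> (\<tau> * cmod U - cmod V)\<^sup>2 / (2 * \<tau>)" using pos by simp
          also have "\<dots> = \<tau> / 2 * (cmod U)\<^sup>2 + 1 / (2 * \<tau>) * (cmod V)\<^sup>2 - cmod U * cmod V"
            using pos by (simp add: power2_eq_square field_simps)
          finally show ?thesis by simp
        qed
        then have "M * (cmod U * cmod V) \<le> M * (\<tau> / 2 * (cmod U)\<^sup>2 + 1 / (2 * \<tau>) * (cmod V)\<^sup>2)"
          by (rule mult_left_mono[OF _ M0])
        also have "\<dots> = M * \<tau> / 2 * (cmod U)\<^sup>2 + M / (2 * \<tau>) * (cmod V)\<^sup>2" by (simp add: algebra_simps)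
        also have "\<dots> \<le> M * \<tau> / 2 * (cmod U)\<^sup>2 + M / (2 * \<tau>) * D"
          using VD M0 pos by (intro add_left_mono mult_left_mono) auto
        also have "\<dots> \<le> (\<epsilon> + M * \<tau>) / 2 * (cmod U)\<^sup>2 + \<epsilon> / 2 * (cmod V)\<^sup>2 + M / (2 * \<tau>) * D"
          using pos(3) by (simp add: add_divide_distrib distrib_right)
        finally show ?thesis .
      qed
    qed
    finally show ?thesis unfolding B U_def V_def .
  qed
  have "norm (of_real c * (of_real (2 * pi) * herm_form W N u v) - of_real (2 * pi) * herm_form H N u v)
    \<le> (\<epsilon> + M * \<tau>) / 2 * (2 * pi * E) + \<epsilon> / 2 * (2 * pi * fh_inverse a N k k)
    + M / (2 * \<tau>) * (2 * (2 * pi * e1) + 4 / \<eta>\<^sup>2 * (2 * pi * e1 + 2 * pi * e2))"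
    by (rule has_integral_norm_le[OF FI BI FB])
  also have "\<dots> = 2 * pi * ((\<epsilon> + M * \<tau>) / 2 * E + \<epsilon> / 2 * fh_inverse a N k k + M / (2 * \<tau>) * (2 * e1 + 4 / \<eta>\<^sup>2 * (e1 + e2)))"
    by (simp add: algebra_simps add_divide_distrib)
  also have "of_real c * (of_real (2 * pi) * herm_form W N u v) - of_real (2 * pi) * herm_form H N u v
      = of_real (2 * pi) * (of_real c * u k - of_real (fh_inverse a N k l0))"
  proof -
    have "herm_form W N u v = u k" unfolding W_def v_def by (rule herm_form_fh_col[OF a kN])
    moreover have "herm_form H N u v = of_real (fh_inverse a N k l0)"
      unfolding form v_def fh_col_def by (simp add: fh_inverse_sym)
    ultimately show ?thesis by (simp add: algebra_simps)
  qed
  also have "norm \<dots> = 2 * pi * cmod (of_real c * u k - of_real (fh_inverse a N k l0))"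
    by (simp add: norm_mult)
  finally have "cmod (of_real c * u k - of_real (fh_inverse a N k l0))
      \<le> (\<epsilon> + M * \<tau>) / 2 * E + \<epsilon> / 2 * fh_inverse a N k k + M / (2 * \<tau>) * (2 * e1 + 4 / \<eta>\<^sup>2 * (e1 + e2))"
    by simp
  also have "(\<epsilon> + M * \<tau>) / 2 * E \<le> (\<epsilon> + M * \<tau>) / 2 * (fh_inverse a N l0 l0 / m\<^sup>2)"
    using m M pos by (intro mult_left_mono Ebound) auto
  finally show ?thesis by simp
qed

text \<open>A continuous-convergence limit is automatically continuous: \<open>G\<close> at the \<open>i\<close>-th point is approximated by
  \<open>fh_inverse\<close> at a large enough order.\<close>

lemma tendsto_G_kernel:
  assumes a: "a > 1 / 2" and x: "\<xi> \<longlonglongrightarrow> x" "\<And>i. 0 < \<xi> i" "\<And>i. \<xi> i < 1" "0 < x" "x < 1"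
    and y: "\<upsilon> \<longlonglongrightarrow> y" "\<And>i. 0 < \<upsilon> i" "\<And>i. \<upsilon> i < 1" "0 < y" "y < 1"
  shows "(\<lambda>i. G_kernel a (\<xi> i) (\<upsilon> i)) \<longlonglongrightarrow> G_kernel a x y"
proof -
  define K where "K = (\<lambda>n s t. fh_inverse a n (nat \<lfloor>real n * s\<rfloor>) (nat \<lfloor>real n * t\<rfloor>) * real n powr (1 - 2 * a))"
  have id: "filterlim (\<lambda>n::nat. n) at_top sequentially" by (rule filterlim_ident)
  have "\<exists>n\<ge>i. dist (K n (\<xi> i) (\<upsilon> i)) (G_kernel a (\<xi> i) (\<upsilon> i) / (Gamma a)\<^sup>2) < 1 / real (Suc i)" for i
  proof -
    have "(\<lambda>n. K n (\<xi> i) (\<upsilon> i)) \<longlonglongrightarrow> G_kernel a (\<xi> i) (\<upsilon> i) / (Gamma a)\<^sup>2"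
      unfolding K_def using x(2,3)[of i] y(2,3)[of i]
      by (intro fh_inverse_scaled_limit[OF a id] tendsto_nat_floor_div[OF id] tendsto_const) (auto intro: less_imp_le)
    from tendstoD[OF this, of "1 / real (Suc i)"] have "\<forall>\<^sub>F n in sequentially. n \<ge> i \<and> dist (K n (\<xi> i) (\<upsilon> i)) (G_kernel a (\<xi> i) (\<upsilon> i) / (Gamma a)\<^sup>2) < 1 / real (Suc i)"
      by (intro eventually_conj eventually_ge_at_top) simp
    then show ?thesis using eventually_sequentially by auto
  qed
  then obtain n where n: "\<And>i. n i \<ge> i" "\<And>i. dist (K (n i) (\<xi> i) (\<upsilon> i)) (G_kernel a (\<xi> i) (\<upsilon> i) / (Gamma a)\<^sup>2) < 1 / real (Suc i)"
    by metis
  have N: "filterlim n at_top sequentially"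
    by (rule filterlim_at_top_mono[OF filterlim_ident]) (simp add: n)
  have "(\<lambda>i. K (n i) (\<xi> i) (\<upsilon> i)) \<longlonglongrightarrow> G_kernel a x y / (Gamma a)\<^sup>2"
    unfolding K_def using x y
    by (intro fh_inverse_scaled_limit[OF a N] tendsto_nat_floor_div[OF N]) (auto intro: less_imp_le)
  moreover have "(\<lambda>i. K (n i) (\<xi> i) (\<upsilon> i) - G_kernel a (\<xi> i) (\<upsilon> i) / (Gamma a)\<^sup>2) \<longlonglongrightarrow> 0"
  proof (rule Lim_null_comparison[OF _ LIMSEQ_inverse_real_of_nat])
    show "\<forall>\<^sub>F i in sequentially. norm (K (n i) (\<xi> i) (\<upsilon> i) - G_kernel a (\<xi> i) (\<upsilon> i) / (Gamma a)\<^sup>2) \<le> inverse (real (Suc i))"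
      using n(2) by (intro always_eventually allI) (simp add: dist_norm inverse_eq_divide less_imp_le)
  qed
  ultimately have "(\<lambda>i. G_kernel a (\<xi> i) (\<upsilon> i) / (Gamma a)\<^sup>2) \<longlonglongrightarrow> G_kernel a x y / (Gamma a)\<^sup>2"
    using tendsto_diff by fastforce
  then have "(\<lambda>i. G_kernel a (\<xi> i) (\<upsilon> i) / (Gamma a)\<^sup>2 * (Gamma a)\<^sup>2) \<longlonglongrightarrow> G_kernel a x y / (Gamma a)\<^sup>2 * (Gamma a)\<^sup>2"
    by (intro tendsto_mult tendsto_const)
  moreover have "Gamma a > 0" using a by (intro Gamma_real_pos) auto
  ultimately show ?thesis by simp
qed

text \<open>In the bound of \<open>toeplitz_inverse_compare\<close> the parameters
  \<open>\<epsilon>\<close> and \<open>\<tau>\<close> are both set to a small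
  \<open>\<delta>\<close>. For fixed \<open>\<delta>\<close> and \<open>\<eta>\<close> the terms
  with \<open>e1\<close> and \<open>e2\<close> vanish in the scaling limit, and the remaining ones
  are proportional to \<open>\<delta>\<close>.\<close>

lemma toeplitz_inverse_limit:
  fixes F :: "real \<Rightarrow> real" and N k l :: "nat \<Rightarrow> nat"
  assumes a: "a > 1 / 2" and F: "continuous_on {-pi..pi} F"
    and m: "m > 0" "\<And>\<theta>. \<theta> \<in> {-pi..pi} \<Longrightarrow> m \<le> F \<theta>" "m \<le> c"
    and M: "\<And>\<theta>. \<theta> \<in> {-pi..pi} \<Longrightarrow> F \<theta> \<le> M" "c \<le> M"
    and near: "\<And>\<epsilon>. \<epsilon> > 0 \<Longrightarrow> \<exists>\<eta>>0. \<forall>\<theta>\<in>{-pi..pi}. cmod (1 - cis \<theta>) < \<eta> \<longrightarrow> \<bar>F \<theta> - c\<bar> \<le> \<epsilon>"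
    and h: "\<And>\<theta>. h (cis \<theta>) = of_real (fh_weight a \<theta> * F \<theta>)"
    and N: "filterlim N at_top sequentially"
    and u: "\<And>i j. j \<le> N i \<Longrightarrow> (\<Sum>p\<le>N i. fourier_coeff h (int p - int j) * u i p) = (if j = l i then 1 else 0)"
    and k: "(\<lambda>i. real (k i) / real (N i)) \<longlonglongrightarrow> x" and l: "(\<lambda>i. real (l i) / real (N i)) \<longlonglongrightarrow> y"
    and x: "0 < x" "x < 1" and y: "0 < y" "y < 1"
  shows "(\<lambda>i. of_real c * u i (k i) * of_real (real (N i) powr (1 - 2 * a))) \<longlonglongrightarrow> complex_of_real (G_kernel a x y / (Gamma a)\<^sup>2)"
proof -
  define N' where "N' = (\<lambda>i. N i - 1)"
  define s where "s = (\<lambda>i. real (N i) powr (1 - 2 * a))"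
  define g where "g = (\<lambda>x y. G_kernel a x y / (Gamma a)\<^sup>2)"
  define e1 where "e1 = (\<lambda>i. fh_inverse a (N i) (k i) (k i) - fh_inverse a (N' i) (k i) (k i))"
  define e2 where "e2 = (\<lambda>i. fh_inverse a (N i) (k i) (k i) - 2 * fh_inverse a (N' i) (k i - 1) (k i) + fh_inverse a (N' i) (k i) (k i))"
  have a0: "a > 0" using a by simp
  have N': "filterlim N' at_top sequentially"
    unfolding N'_def using filterlim_minus_const_nat_at_top N by (rule filterlim_compose)
  have Nr: "filterlim (\<lambda>i. real (N i)) at_top sequentially"
    by (rule filterlim_compose[OF filterlim_real_sequentially N])
  have Npos: "\<forall>\<^sub>F i in sequentially. N i > 1"
    by (rule eventually_compose_filterlim[OF eventually_gt_at_top N])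
  have ratio: "(\<lambda>i. real (N i) / real (N' i)) \<longlonglongrightarrow> 1"
  proof -
    have "((\<lambda>r::real. r / (r - 1)) \<longlongrightarrow> 1) at_top" by real_asymp
    from filterlim_compose[OF this Nr] have "(\<lambda>i. real (N i) / (real (N i) - 1)) \<longlonglongrightarrow> 1" .
    then show ?thesis
      by (rule Lim_transform_eventually) (use Npos in eventually_elim, auto simp: N'_def of_nat_diff)
  qed
  have shift: "(\<lambda>i. real (j i) / real (N' i)) \<longlonglongrightarrow> z" if "(\<lambda>i. real (j i) / real (N i)) \<longlonglongrightarrow> z" for j z
  proof -
    have "(\<lambda>i. real (j i) / real (N i) * (real (N i) / real (N' i))) \<longlonglongrightarrow> z * 1"
      by (intro tendsto_mult that ratio)
    then show ?thesis
      unfolding mult_1_right by (rule Lim_transform_eventually) (use Npos in eventually_elim, auto)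
  qed
  have k1: "(\<lambda>i. real (k i - 1) / real (N i)) \<longlonglongrightarrow> x"
  proof -
    have pk: "\<forall>\<^sub>F i in sequentially. 0 < real (k i) / real (N i)"
      by (rule order_tendstoD(1)[OF k x(1)])
    have "(\<lambda>i. real (k i) / real (N i) - 1 / real (N i)) \<longlonglongrightarrow> x - 0"
      by (intro tendsto_diff k filterlim_compose[OF lim_1_over_n N])
    then show ?thesis
      unfolding diff_0_right by (rule Lim_transform_eventually) (use pk in eventually_elim, auto simp: of_nat_diff diff_divide_distrib Suc_leI zero_less_divide_iff)
  qed
  have lim: "(\<lambda>i. fh_inverse a (N i) (p i) (q i) * s i) \<longlonglongrightarrow> g w z"
    if "(\<lambda>i. real (p i) / real (N i)) \<longlonglongrightarrow> w" "(\<lambda>i. real (q i) / real (N i)) \<longlonglongrightarrow> z" "0 < w" "w < 1" "0 < z" "z < 1" for p q w z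
    unfolding s_def g_def by (rule fh_inverse_scaled_limit[OF a N that])
  have lim': "(\<lambda>i. fh_inverse a (N' i) (p i) (q i) * s i) \<longlonglongrightarrow> g w z"
    if "(\<lambda>i. real (p i) / real (N i)) \<longlonglongrightarrow> w" "(\<lambda>i. real (q i) / real (N i)) \<longlonglongrightarrow> z" "0 < w" "w < 1" "0 < z" "z < 1" for p q w z
  proof -
    have "(\<lambda>i. fh_inverse a (N' i) (p i) (q i) * real (N' i) powr (1 - 2 * a) * (real (N i) / real (N' i)) powr (1 - 2 * a)) \<longlonglongrightarrow> g w z * 1 powr (1 - 2 * a)"
      unfolding g_def using that
      by (intro tendsto_mult fh_inverse_scaled_limit[OF a N'] shift tendsto_powr ratio tendsto_const) auto
    then have "(\<lambda>i. fh_inverse a (N' i) (p i) (q i) * real (N' i) powr (1 - 2 * a) * (real (N i) / real (N' i)) powr (1 - 2 * a)) \<longlonglongrightarrow> g w z" by simp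
    then show ?thesis
      by (rule Lim_transform_eventually) (use Npos in eventually_elim, auto simp: s_def powr_divide N'_def)
  qed
  have L1: "(\<lambda>i. e1 i * s i) \<longlonglongrightarrow> 0"
    using tendsto_diff[OF lim[OF k k x x] lim'[OF k k x x]] by (simp add: e1_def algebra_simps)
  \<comment> \<open>All three entries have the limit \<open>g x x\<close>, since the offset in
    \<open>k - 1\<close> is invisible at scale \<open>N\<close>; their weights 1, -2, 1 add up to
    0.\<close>
  have L2: "(\<lambda>i. e2 i * s i) \<longlonglongrightarrow> 0"
    using tendsto_add[OF tendsto_diff[OF lim[OF k k x x] tendsto_mult_left[OF lim'[OF k1 k x x], of 2]] lim'[OF k k x x]]
    by (simp add: e2_def algebra_simps)
  have Lk: "(\<lambda>i. fh_inverse a (N i) (k i) (k i) * s i) \<longlonglongrightarrow> g x x" by (rule lim[OF k k x x])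
  have Ll: "(\<lambda>i. fh_inverse a (N i) (l i) (l i) * s i) \<longlonglongrightarrow> g y y" by (rule lim[OF l l y y])
  have s0: "s i \<ge> 0" for i by (simp add: s_def)
  have "(\<lambda>i. of_real c * u i (k i) * of_real (s i) - of_real (fh_inverse a (N i) (k i) (l i) * s i)) \<longlonglongrightarrow> (0::complex)"
  proof (rule tendsto_norm_zero_cancel, rule order_tendstoI)
    fix r :: real assume "r < 0"
    then show "\<forall>\<^sub>F i in sequentially. r < norm (of_real c * u i (k i) * of_real (s i) - complex_of_real (fh_inverse a (N i) (k i) (l i) * s i))"
      by (intro always_eventually allI) (meson norm_ge_zero less_le_trans)
  next
    fix r :: real assume r: "0 < r"
    \<comment> \<open>\<open>\<delta> * A\<close> is the limit of the scaled bound when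
      \<open>\<epsilon> = \<tau> = \<delta>\<close>. Dividing by \<open>\<bar>A\<bar> + 1\<close> in
      \<open>\<delta>\<close> makes the sign of \<open>A\<close>, and \<open>A = 0\<close>,
      harmless.\<close>
    define A where "A = (1 + M) / 2 * (g y y / m\<^sup>2) + 1 / 2 * g x x"
    define \<delta> where "\<delta> = r / (2 * (\<bar>A\<bar> + 1))"
    have \<delta>: "\<delta> > 0" "\<delta> * A < r"
    proof -
      show "\<delta> > 0" using r by (simp add: \<delta>_def)
      then have "\<delta> * A \<le> \<delta> * (\<bar>A\<bar> + 1)" by (intro mult_left_mono) auto
      also have "\<dots> = r / 2"
        unfolding \<delta>_def using abs_ge_zero[of A] by (simp add: field_simps add_pos_nonneg del: abs_ge_zero)
      finally show "\<delta> * A < r" using r by simp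
    qed
    obtain \<eta> where \<eta>: "\<eta> > 0" "\<And>\<theta>. \<theta> \<in> {-pi..pi} \<Longrightarrow> cmod (1 - cis \<theta>) < \<eta> \<Longrightarrow> \<bar>F \<theta> - c\<bar> \<le> \<delta>"
      using near[OF \<delta>(1)] by blast
    define B where "B = (\<lambda>i. (\<delta> + M * \<delta>) / 2 * (fh_inverse a (N i) (l i) (l i) * s i / m\<^sup>2) + \<delta> / 2 * (fh_inverse a (N i) (k i) (k i) * s i)
      + M / (2 * \<delta>) * (2 * (e1 i * s i) + 4 / \<eta>\<^sup>2 * (e1 i * s i + e2 i * s i)))"
    have "B \<longlonglongrightarrow> (\<delta> + M * \<delta>) / 2 * (g y y / m\<^sup>2) + \<delta> / 2 * g x x + M / (2 * \<delta>) * (2 * 0 + 4 / \<eta>\<^sup>2 * (0 + 0))"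
      unfolding B_def using m(1) by (intro tendsto_intros Lk Ll L1 L2) auto
    also have "(\<delta> + M * \<delta>) / 2 * (g y y / m\<^sup>2) + \<delta> / 2 * g x x + M / (2 * \<delta>) * (2 * 0 + 4 / \<eta>\<^sup>2 * (0 + 0)) = \<delta> * A"
      by (simp add: A_def algebra_simps add_divide_distrib)
    finally have "\<forall>\<^sub>F i in sequentially. B i < r" using \<delta>(2) by (rule order_tendstoD(2))
    moreover have "\<forall>\<^sub>F i in sequentially. 0 < real (k i) / real (N i)"
      by (rule order_tendstoD(1)[OF k x(1)])
    moreover have "\<forall>\<^sub>F i in sequentially. real (k i) / real (N' i) < 1"
      by (rule order_tendstoD(2)[OF shift[OF k] x(2)])
    moreover have "\<forall>\<^sub>F i in sequentially. real (l i) / real (N i) < 1"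
      by (rule order_tendstoD(2)[OF l y(2)])
    ultimately show "\<forall>\<^sub>F i in sequentially. norm (of_real c * u i (k i) * of_real (s i) - complex_of_real (fh_inverse a (N i) (k i) (l i) * s i)) < r"
      using Npos
    proof eventually_elim
      case (elim i)
      have ineqs: "l i \<le> N i" "1 \<le> k i" "k i \<le> N' i" "N i = Suc (N' i)"
        using elim by (auto simp: N'_def divide_less_eq zero_less_divide_iff Suc_le_eq)
      have "cmod (of_real c * u i (k i) - of_real (fh_inverse a (N i) (k i) (l i))) \<le>
        (\<delta> + M * \<delta>) / 2 * (fh_inverse a (N i) (l i) (l i) / m\<^sup>2) + \<delta> / 2 * fh_inverse a (N i) (k i) (k i)
        + M / (2 * \<delta>) * (2 * e1 i + 4 / \<eta>\<^sup>2 * (e1 i + e2 i))"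
        by (rule toeplitz_inverse_compare[OF a0 F m M \<eta>(1) \<delta>(1) less_imp_le[OF \<delta>(1)] \<eta>(2) h u ineqs(4,1,2,3)])
          (simp_all add: e1_def e2_def)
      from mult_right_mono[OF this s0[of i]]
      also have "((\<delta> + M * \<delta>) / 2 * (fh_inverse a (N i) (l i) (l i) / m\<^sup>2) + \<delta> / 2 * fh_inverse a (N i) (k i) (k i)
        + M / (2 * \<delta>) * (2 * e1 i + 4 / \<eta>\<^sup>2 * (e1 i + e2 i))) * s i = B i"
        by (simp add: B_def algebra_simps add_divide_distrib)
      finally have "cmod (of_real c * u i (k i) - of_real (fh_inverse a (N i) (k i) (l i))) * s i \<le> B i" .
      moreover have "norm (of_real c * u i (k i) * of_real (s i) - complex_of_real (fh_inverse a (N i) (k i) (l i) * s i))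
         = cmod ((of_real c * u i (k i) - of_real (fh_inverse a (N i) (k i) (l i))) * of_real (s i))"
        by (simp add: algebra_simps)
      ultimately show ?case using elim(1) s0[of i] by (simp add: norm_mult)
    qed
  qed
  moreover have "(\<lambda>i. complex_of_real (fh_inverse a (N i) (k i) (l i) * s i)) \<longlonglongrightarrow> of_real (g x y)"
    by (intro tendsto_of_real lim k l x y)
  ultimately have "(\<lambda>i. of_real c * u i (k i) * of_real (s i)) \<longlonglongrightarrow> 0 + complex_of_real (g x y)"
    using tendsto_add by fastforce
  then show ?thesis by (simp add: s_def g_def)
qed

text \<open>A kernel vector has zero energy for the full symbol, hence for the pure weight because
  \<open>F\<close> is at least \<open>m\<close>. Pairing it with the columns of the pure inverse
  then shows that all its coefficients vanish.\<close>

lemma toeplitz_invertible: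
  fixes F :: "real \<Rightarrow> real"
  assumes a: "a > 0" and F: "continuous_on {-pi..pi} F"
    and m: "m > 0" "\<And>\<theta>. \<theta> \<in> {-pi..pi} \<Longrightarrow> m \<le> F \<theta>"
    and h: "\<And>\<theta>. h (cis \<theta>) = of_real (fh_weight a \<theta> * F \<theta>)"
  shows "det (toeplitz N h) \<noteq> 0"
proof
  have T: "toeplitz N h \<in> carrier_mat (N + 1) (N + 1)" by (simp add: toeplitz_def)
  assume "det (toeplitz N h) = 0"
  then obtain v where v: "v \<in> carrier_vec (N + 1)" "v \<noteq> 0\<^sub>v (N + 1)" "toeplitz N h *\<^sub>v v = 0\<^sub>v (N + 1)"
    using det_0_iff_vec_prod_zero_field[OF T] by blast
  define u where "u = (\<lambda>l. v $ l)"
  define H where "H = (\<lambda>\<theta>. fh_weight a \<theta> * F \<theta>)"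
  have W: "continuous_on {-pi..pi} (fh_weight a)" using a by (rule continuous_on_fh_weight)
  have H: "continuous_on {-pi..pi} H" unfolding H_def by (intro continuous_intros W F)
  have ker: "(\<Sum>l\<le>N. fourier_coeff h (int l - int k) * u l) = 0" if "k \<le> N" for k
  proof -
    have "0 = (toeplitz N h *\<^sub>v v) $ k" unfolding v(3) using that by simp
    also have "\<dots> = (\<Sum>l = 0..<N + 1. fourier_coeff h (int l - int k) * u l)"
      using that v(1) by (simp add: toeplitz_def scalar_prod_def u_def)
    also have "{0..<N + 1} = {..N}" by auto
    finally show ?thesis ..
  qed
  have hH: "h (cis \<theta>) = of_real (H \<theta>)" for \<theta> unfolding H_def by (rule h)
  have "herm_form H N u u = (\<Sum>k\<le>N. cnj (u k) * 0)"
    by (rule herm_form_toeplitz[OF hH H ker])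
  then have "energy H N u = 0" using herm_form_self[OF H, of N u] by simp
  moreover have "m * energy (fh_weight a) N u \<le> energy H N u"
  proof (rule energy_mono[OF W H])
    fix \<theta> assume "\<theta> \<in> {-pi..pi}"
    from mult_right_mono[OF m(2)[OF this] fh_weight_nonneg[of a \<theta>]]
    show "m * fh_weight a \<theta> \<le> H \<theta>" by (simp add: H_def mult.commute)
  qed
  moreover have "energy (fh_weight a) N u \<ge> 0" by (intro energy_nonneg W fh_weight_nonneg)
  ultimately have E: "energy (fh_weight a) N u = 0" using m(1) by (simp add: mult_le_0_iff)
  have "u l = 0" if l: "l \<le> N" for l
  proof (rule ccontr)
    define K where "K = fh_inverse a N l l"
    assume "u l \<noteq> 0"
    then have p: "cmod (u l) > 0" by simp
    have le: "cmod (u l) \<le> K / t / 2" if "t > 0" for t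
      using norm_herm_form_le[OF W fh_weight_nonneg that, of N u "fh_col a N l"]
      by (simp add: herm_form_fh_col[OF a l] energy_fh_col[OF a l] E K_def)
    have "cmod (u l) \<le> K / 2" using le[of 1] by simp
    then have K: "K > 0" using p by linarith
    \<comment> \<open>This \<open>t\<close> makes the right side half of the left side.\<close>
    have "cmod (u l) \<le> K / (K / cmod (u l)) / 2" by (rule le[OF divide_pos_pos[OF K p]])
    then show False using K p by simp
  qed
  then have "v = 0\<^sub>v (N + 1)" using v(1) by (intro eq_vecI) (auto simp: u_def)
  with v(2) show False by simp
qed

text \<open>A nonzero determinant excludes \<open>None\<close>; the columns of the computed inverse
  then solve the linear systems assumed in \<open>toeplitz_inverse_limit\<close>.\<close>

lemma mat_inverse_toeplitz:
  assumes "det (toeplitz N h) \<noteq> 0"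
  shows "invertible_mat (toeplitz N h)"
    and "k \<le> N \<Longrightarrow> l \<le> N \<Longrightarrow>
      (\<Sum>p\<le>N. fourier_coeff h (int p - int k) * the (mat_inverse (toeplitz N h)) $$ (p, l)) = (if k = l then 1 else 0)"
proof -
  have T: "toeplitz N h \<in> carrier_mat (N + 1) (N + 1)" by (simp add: toeplitz_def)
  from det_non_zero_imp_unit[OF T assms, of "()"] mat_inverse(1)[OF T, of "()"]
  obtain B where B: "mat_inverse (toeplitz N h) = Some B" by auto
  from mat_inverse(2)[OF T this] have TB: "toeplitz N h * B = 1\<^sub>m (N + 1)" "B * toeplitz N h = 1\<^sub>m (N + 1)" "B \<in> carrier_mat (N + 1) (N + 1)"
    by auto
  then show "invertible_mat (toeplitz N h)"
    using T by (auto simp: invertible_mat_def inverts_mat_def)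
  assume kl: "k \<le> N" "l \<le> N"
  have "(toeplitz N h * B) $$ (k, l) = (\<Sum>p = 0..<N + 1. fourier_coeff h (int p - int k) * B $$ (p, l))"
    using kl TB(3) by (simp add: toeplitz_def scalar_prod_def)
  also have "{0..<N + 1} = {..N}" by auto
  finally show "(\<Sum>p\<le>N. fourier_coeff h (int p - int k) * the (mat_inverse (toeplitz N h)) $$ (p, l)) = (if k = l then 1 else 0)"
    using kl by (simp add: B TB(1))
qed

section \<open>Uniformity by compactness\<close>

theorem mainTheorem2:
  fixes \<alpha> :: real and f\<^sub>1 :: "complex \<Rightarrow> real"
  assumes "\<alpha> > 1 / 2"
    and "(\<lambda>z. complex_of_real (f\<^sub>1 z)) \<in> A_torus (3 / 2)"
    and "continuous_on (sphere 0 1) f\<^sub>1"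
    and "\<And>z. z \<in> sphere 0 1 \<Longrightarrow> f\<^sub>1 z > 0"
  shows "(\<forall>N. invertible_mat (toeplitz N (singular_symbol \<alpha> f\<^sub>1))) \<and>
    (\<forall>\<delta>\<^sub>1 \<delta>\<^sub>2. 0 < \<delta>\<^sub>1 \<longrightarrow> \<delta>\<^sub>2 < 1 \<longrightarrow>
      (\<forall>\<epsilon>>0. \<forall>\<^sub>F N in sequentially. \<forall>x\<in>{\<delta>\<^sub>1..\<delta>\<^sub>2}. \<forall>y\<in>{\<delta>\<^sub>1..\<delta>\<^sub>2}.
        cmod (complex_of_real (f\<^sub>1 1) *
                the (mat_inverse (toeplitz N (singular_symbol \<alpha> f\<^sub>1)))
                  $$ (nat \<lfloor>real N * x\<rfloor>, nat \<lfloor>real N * y\<rfloor>)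
              - complex_of_real (real N powr (2 * \<alpha> - 1) * (1 / (Gamma \<alpha>)\<^sup>2) * G_kernel \<alpha> x y))
        \<le> \<epsilon> * real N powr (2 * \<alpha> - 1)))"
proof -
  define h where "h = singular_symbol \<alpha> f\<^sub>1"
  define F where "F = (\<lambda>\<theta>. f\<^sub>1 (cis \<theta>))"
  define c where "c = f\<^sub>1 1"
  have cont: "continuous_on (sphere 0 1) f\<^sub>1" by fact
  have F: "continuous_on S F" for S
    unfolding F_def by (rule continuous_on_compose2[OF cont]) (auto intro!: continuous_intros)
  have h: "h (cis \<theta>) = of_real (fh_weight \<alpha> \<theta> * F \<theta>)" for \<theta>
    by (simp add: h_def singular_symbol_def cmod_one_minus_cis F_def)
  have ne: "sphere (0::complex) 1 \<noteq> {}" using norm_one by fastforce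
  obtain z0 where z0: "z0 \<in> sphere 0 1" "\<And>z. z \<in> sphere 0 1 \<Longrightarrow> f\<^sub>1 z0 \<le> f\<^sub>1 z"
    using continuous_attains_inf[OF compact_sphere ne cont] by blast
  obtain z1 where z1: "z1 \<in> sphere 0 1" "\<And>z. z \<in> sphere 0 1 \<Longrightarrow> f\<^sub>1 z \<le> f\<^sub>1 z1"
    using continuous_attains_sup[OF compact_sphere ne cont] by blast
  define m M where "m = f\<^sub>1 z0" and "M = f\<^sub>1 z1"
  have m: "m > 0" "\<And>\<theta>. m \<le> F \<theta>" "m \<le> c"
    using assms(4)[OF z0(1)] z0(2) by (auto simp: m_def F_def c_def)
  have M: "\<And>\<theta>. F \<theta> \<le> M" "c \<le> M"
    using z1(2) by (auto simp: M_def F_def c_def)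
  have near: "\<exists>\<eta>>0. \<forall>\<theta>\<in>{-pi..pi}. cmod (1 - cis \<theta>) < \<eta> \<longrightarrow> \<bar>F \<theta> - c\<bar> \<le> \<epsilon>" if "\<epsilon> > 0" for \<epsilon>
  proof -
    have "(1::complex) \<in> sphere 0 1" by simp
    then obtain \<eta> where "\<eta> > 0" "\<And>z. z \<in> sphere 0 1 \<Longrightarrow> dist z 1 < \<eta> \<Longrightarrow> dist (f\<^sub>1 z) (f\<^sub>1 1) < \<epsilon>"
      using cont \<open>\<epsilon> > 0\<close> unfolding continuous_on_iff by blast
    then show ?thesis
      by (intro exI[of _ \<eta>]) (auto simp: F_def c_def dist_norm norm_minus_commute intro: less_imp_le)
  qed
  have a0: "\<alpha> > 0" using assms(1) by simp
  have det: "det (toeplitz N h) \<noteq> 0" for N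
    by (rule toeplitz_invertible[OF a0 F m(1) m(2) h])
  have inv: "invertible_mat (toeplitz N h)" for N
    by (rule mat_inverse_toeplitz(1)[OF det])
  define A where "A = (\<lambda>N x y. the (mat_inverse (toeplitz N h)) $$ (nat \<lfloor>real N * x\<rfloor>, nat \<lfloor>real N * y\<rfloor>))"
  \<comment> \<open>If the uniform estimate failed, it would fail at arbitrarily large orders, each
    with its own pair of points.\<close>
  define bad where "bad = (\<lambda>\<epsilon> N x y. \<epsilon> * real N powr (2 * \<alpha> - 1) <
    cmod (of_real c * A N x y - of_real (real N powr (2 * \<alpha> - 1) * (1 / (Gamma \<alpha>)\<^sup>2) * G_kernel \<alpha> x y)))"
  have "\<forall>\<^sub>F N in sequentially. \<forall>x\<in>{d1..d2}. \<forall>y\<in>{d1..d2}. \<not> bad \<epsilon> N x y"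
    if d: "0 < d1" "d2 < 1" and \<epsilon>: "\<epsilon> > 0" for d1 d2 \<epsilon>
  proof (rule ccontr)
    assume "\<not> ?thesis"
    then have "\<forall>n. \<exists>N\<ge>n. \<exists>p\<in>{d1..d2}\<times>{d1..d2}. bad \<epsilon> N (fst p) (snd p)"
      unfolding eventually_sequentially by force
    then obtain N p where N: "\<And>n. N n \<ge> n" and p: "\<And>n. p n \<in> {d1..d2}\<times>{d1..d2}" and bad: "\<And>n. bad \<epsilon> (N n) (fst (p n)) (snd (p n))"
      by metis
    \<comment> \<open>A subsequence of the bad points converges inside the square, hence away from 0
      and 1, where the sequential limits apply.\<close>
    have "seq_compact ({d1..d2}\<times>{d1..d2})"
      by (intro compact_imp_seq_compact compact_Times compact_Icc)
    then obtain q r where q: "q \<in> {d1..d2}\<times>{d1..d2}" and r: "strict_mono r" "(p \<circ> r) \<longlonglongrightarrow> q"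
      using p by (metis seq_compactE)
    define x y where "x = fst q" and "y = snd q"
    define \<xi> \<upsilon> n where "\<xi> = (\<lambda>i. fst (p (r i)))" and "\<upsilon> = (\<lambda>i. snd (p (r i)))" and "n = (\<lambda>i. N (r i))"
    have xy: "0 < x" "x < 1" "0 < y" "y < 1" using q d by (auto simp: x_def y_def mem_Times_iff)
    have \<xi>\<upsilon>: "0 < \<xi> i" "\<xi> i < 1" "0 < \<upsilon> i" "\<upsilon> i < 1" for i
      using p[of "r i"] d by (auto simp: \<xi>_def \<upsilon>_def mem_Times_iff)
    have lim: "\<xi> \<longlonglongrightarrow> x" "\<upsilon> \<longlonglongrightarrow> y"
      using tendsto_fst[OF r(2)] tendsto_snd[OF r(2)] by (simp_all add: \<xi>_def \<upsilon>_def x_def y_def)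
    have n: "filterlim n at_top sequentially"
      by (rule filterlim_at_top_mono[OF filterlim_subseq[OF r(1)]]) (simp add: n_def N)
    have "nat \<lfloor>real (n i) * \<upsilon> i\<rfloor> \<le> n i" for i
    proof -
      have "real (n i) * \<upsilon> i \<le> real (n i) * 1" using \<xi>\<upsilon>(4)[of i] by (intro mult_left_mono) auto
      then show ?thesis by linarith
    qed
    then have u: "(\<Sum>p\<le>n i. fourier_coeff h (int p - int j) * the (mat_inverse (toeplitz (n i) h)) $$ (p, nat \<lfloor>real (n i) * \<upsilon> i\<rfloor>))
        = (if j = nat \<lfloor>real (n i) * \<upsilon> i\<rfloor> then 1 else 0)" if "j \<le> n i" for i j
      using mat_inverse_toeplitz(2)[OF det that] by blast
    define s where "s = (\<lambda>i. real (n i) powr (1 - 2 * \<alpha>))"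
    have "(\<lambda>i. of_real c * A (n i) (\<xi> i) (\<upsilon> i) * of_real (s i)) \<longlonglongrightarrow> complex_of_real (G_kernel \<alpha> x y / (Gamma \<alpha>)\<^sup>2)"
      unfolding A_def s_def
      by (rule toeplitz_inverse_limit[OF assms(1) F m M near h n u])
        (use lim xy \<xi>\<upsilon> in \<open>auto intro!: tendsto_nat_floor_div[OF n] less_imp_le\<close>)
    \<comment> \<open>The estimate compares with \<open>G\<close> at the moving points, so
      continuity of \<open>G\<close> is needed in addition to the limit of the entries.\<close>
    moreover have "(\<lambda>i. complex_of_real (G_kernel \<alpha> (\<xi> i) (\<upsilon> i) / (Gamma \<alpha>)\<^sup>2)) \<longlonglongrightarrow> complex_of_real (G_kernel \<alpha> x y / (Gamma \<alpha>)\<^sup>2)"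
    proof -
      have "(Gamma \<alpha>)\<^sup>2 \<noteq> 0" using Gamma_real_pos[OF a0] by simp
      then show ?thesis using \<xi>\<upsilon> xy lim assms(1)
        by (intro tendsto_of_real tendsto_divide tendsto_const tendsto_G_kernel) auto
    qed
    ultimately have "(\<lambda>i. of_real c * A (n i) (\<xi> i) (\<upsilon> i) * of_real (s i) - complex_of_real (G_kernel \<alpha> (\<xi> i) (\<upsilon> i) / (Gamma \<alpha>)\<^sup>2)) \<longlonglongrightarrow> 0"
      using tendsto_diff by fastforce
    from tendstoD[OF this \<epsilon>] have "\<forall>\<^sub>F i in sequentially. cmod (of_real c * A (n i) (\<xi> i) (\<upsilon> i) * of_real (s i) - complex_of_real (G_kernel \<alpha> (\<xi> i) (\<upsilon> i) / (Gamma \<alpha>)\<^sup>2)) < \<epsilon>"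
      by (simp add: dist_norm)
    moreover have "\<forall>\<^sub>F i in sequentially. n i > 0"
      by (rule eventually_compose_filterlim[OF eventually_gt_at_top n])
    ultimately have "\<forall>\<^sub>F i in sequentially. False"
    proof eventually_elim
      case (elim i)
      define S where "S = real (n i) powr (2 * \<alpha> - 1)"
      have S: "S > 0" "s i * S = 1" using elim(2) by (simp_all add: S_def s_def powr_add[symmetric])
      have "of_real c * A (n i) (\<xi> i) (\<upsilon> i) - of_real (S * (1 / (Gamma \<alpha>)\<^sup>2) * G_kernel \<alpha> (\<xi> i) (\<upsilon> i))
         = (of_real c * A (n i) (\<xi> i) (\<upsilon> i) * of_real (s i) - complex_of_real (G_kernel \<alpha> (\<xi> i) (\<upsilon> i) / (Gamma \<alpha>)\<^sup>2)) * of_real S"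
      proof -
        have "complex_of_real (s i) * of_real S = 1" using S(2) by (metis of_real_1 of_real_mult)
        then show ?thesis by (simp add: left_diff_distrib mult.assoc)
      qed
      then have "cmod (of_real c * A (n i) (\<xi> i) (\<upsilon> i) - of_real (S * (1 / (Gamma \<alpha>)\<^sup>2) * G_kernel \<alpha> (\<xi> i) (\<upsilon> i))) < \<epsilon> * S"
        using elim(1) S(1) by (simp add: norm_mult)
      moreover have "\<epsilon> * S < cmod (of_real c * A (n i) (\<xi> i) (\<upsilon> i) - of_real (S * (1 / (Gamma \<alpha>)\<^sup>2) * G_kernel \<alpha> (\<xi> i) (\<upsilon> i)))"
        using bad[of "r i"] unfolding bad_def S_def n_def \<xi>_def \<upsilon>_def .
      ultimately show False by simp
    qed
    then show False by simp
  qed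
  then show ?thesis
    using inv unfolding bad_def A_def h_def c_def not_less by (intro conjI allI impI) assumption+
qed

end
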